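(* Let $S$ be a locally Noetherian algebraic space and let $e:\mathcal{W}\to\mathcal{X}$ and $f:\mathcal{X}\to\mathcal{Y}$ be 1-morphisms of stacks in groupoids over $(\mathrm{Aff}/S)$ for the étale topology. If for both $e$ and $f$ every generic lift of an integral, algebraic deformation situation has an integral lift, then the same holds for $f\circ e$.
   Context: $(\mathrm{Aff}/S)$ is the category of affine schemes over $S$; an $\mathcal{O}_S$-algebra is a ring $A$ with a morphism $\mathrm{Spec}\,A\to S$; $a|_B$ denotes pullback along $A\to B$. An infinitesimal extension is a surjection of Noetherian $\mathcal{O}_S$-algebras with nilpotent kernel. An extension pair $(B'\xrightarrow{q}B\xrightarrow{q_0}B_0)$ is a pair of infinitesimal extensions with $B_0$ reduced and $M=\ker q$ annihilated by $\ker(q_0\circ q)$. A deformation situation over a 1-morphism $f:\mathcal{X}\to\mathcal{Y}$ consists of an extension pair, an object $b'_{\mathcal{Y}}\in\mathcal{Y}(\mathrm{Spec}\,B')$, an object $b_{\mathcal{X}}\in\mathcal{X}(\mathrm{Spec}\,B)$ and an isomorphism $f(b_{\mathcal{X}})\cong b'_{\mathcal{Y}}|_B$. It is algebraic if $B_0$ is of finite type over $\mathcal{O}_S$, integral if $B_0$ is an integral domain. A lift of it is an object $b'_{\mathcal{X}}\in\mathcal{X}(\mathrm{Spec}\,B')$ with isomorphisms $b'_{\mathcal{X}}|_B\cong b_{\mathcal{X}}$ and $f(b'_{\mathcal{X}})\cong b'_{\mathcal{Y}}$ compatible with the given isomorphism. Deformation situations are base changed along commutative diagrams of extension pairs by pulling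 back $b'_{\mathcal{Y}}$ and $b_{\mathcal{X}}$. Localizations of $B'$, $B$ and $B_0$ correspond bijectively. Given an integral deformation situation, let $A_0=\mathrm{Frac}(B_0)$, let $A$, $A'$ be the associated localizations of $B$, $B'$, and let $q_A:A'\to A$ be the induced extension. A generic lift is a lift of the base change of the deformation situation to $(A'\to A\to A_0)$. An integral lift of a generic lift is given by: (i) an infinitesimal extension $B'_{\mathrm{new}}\to B$ sitting between $B'$ and $q_A^{-1}(B)$, i.e. an $\mathcal{O}_S$-subalgebra $B'_{\mathrm{new}}$ of $A'\times_AB$ containing the image of $B'$, with its projection to $B$; (ii) a lift of the deformation situation over $(B'_{\mathrm{new}}\to B\to B_0)$ obtained by base change of the original one (so the image in $\mathcal{Y}$ is $b'_{\mathcal{Y}}|_{B'_{\mathrm{new}}}$); (iii) such that the base change of this lift to $A'$ is the given generic lift. *)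

theory Defs
  imports "HOL-Algebra.Algebra"
begin

no_notation var (\<open>X\<index>\<close>)

section \<open>Commutative algebra\<close>

text \<open>
  Rings are HOL-Algebra rings whose elements are taken from one type \<open>'a\<close>, which plays the role of
  the universe: for infinite \<open>'a\<close> these are, up to isomorphism, all rings of cardinality at most
  that of \<open>'a\<close>, and this class is closed under localizations, fibre products, tensor products,
  residue fields and algebras of finite type.

  A morphism of the category of rings is a ring homomorphism that is \<^const>\<open>undefined\<close> off the
  carrier, so that morphisms are equal iff they agree on the carrier.
  The composite of \<open>g\<close> after \<open>f\<close> is \<open>compose (carrier R) g f\<close>.
\<close>

definition chom :: "('a, 'k) ring_scheme \<Rightarrow> ('b, 'l) ring_scheme \<Rightarrow> ('a \<Rightarrow> 'b) set" where
  "chom R T = ring_hom R T \<inter> extensional (carrier R)"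

abbreviation idhom :: "('a, 'k) ring_scheme \<Rightarrow> 'a \<Rightarrow> 'a" where
  "idhom R \<equiv> (\<lambda>x\<in>carrier R. x)"

definition reduced :: "('a, 'k) ring_scheme \<Rightarrow> bool" where
  "reduced R \<longleftrightarrow> (\<forall>x\<in>carrier R. \<forall>n::nat. x [^]\<^bsub>R\<^esub> n = \<zero>\<^bsub>R\<^esub> \<longrightarrow> x = \<zero>\<^bsub>R\<^esub>)"

definition nilpotent_ideal :: "('a, 'k) ring_scheme \<Rightarrow> 'a set \<Rightarrow> bool" where
  "nilpotent_ideal R I \<longleftrightarrow> (\<exists>n. (ideal_prod R I ^^ n) (carrier R) = {\<zero>\<^bsub>R\<^esub>})"

text \<open>\<open>l\<close> exhibits \<open>A\<close> as (a model of) the localization \<open>T\<^sup>-\<^sup>1R\<close>.\<close>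

definition is_localization ::
    "('a, 'k) ring_scheme \<Rightarrow> 'a set \<Rightarrow> ('b, 'l) ring_scheme \<Rightarrow> ('a \<Rightarrow> 'b) \<Rightarrow> bool" where
  "is_localization R T A l \<longleftrightarrow>
     l \<in> chom R A \<and> l ` T \<subseteq> Units A \<and>
     (\<forall>a\<in>carrier A. \<exists>r\<in>carrier R. \<exists>t\<in>T. a \<otimes>\<^bsub>A\<^esub> l t = l r) \<and>
     (\<forall>r\<in>carrier R. \<forall>r'\<in>carrier R. l r = l r' \<longrightarrow> (\<exists>t\<in>T. t \<otimes>\<^bsub>R\<^esub> r = t \<otimes>\<^bsub>R\<^esub> r'))"

text \<open>
  The polynomial ring over \<open>R\<close> in the variables indexed by \<open>{..<n}\<close>; a monomial is a multiset of
  indices.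
\<close>

definition mpoly_ring :: "('a, 'k) ring_scheme \<Rightarrow> nat \<Rightarrow> (nat multiset \<Rightarrow> 'a) ring" where
  "mpoly_ring R n =
     \<lparr>carrier = ring.indexed_pset R {..<n} (carrier R),
      monoid.mult = (\<lambda>p p' m. finsum R (\<lambda>k. p k \<otimes>\<^bsub>R\<^esub> p' (m - k)) {k. k \<subseteq># m}),
      one = ring.indexed_const R \<one>\<^bsub>R\<^esub>,
      ring.zero = ring.indexed_const R \<zero>\<^bsub>R\<^esub>,
      ring.add = ring.indexed_padd R\<rparr>"

definition mpoly_eval ::
    "('a, 'k) ring_scheme \<Rightarrow> ('b, 'l) ring_scheme \<Rightarrow> ('a \<Rightarrow> 'b) \<Rightarrow> (nat \<Rightarrow> 'b)
      \<Rightarrow> (nat multiset \<Rightarrow> 'a) \<Rightarrow> 'b" where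
  "mpoly_eval R T h x p =
     finsum T (\<lambda>m. h (p m) \<otimes>\<^bsub>T\<^esub> finprod T (\<lambda>i. x i [^]\<^bsub>T\<^esub> count m i) (set_mset m))
       {m. p m \<noteq> \<zero>\<^bsub>R\<^esub>}"

definition finite_type_hom ::
    "('a, 'k) ring_scheme \<Rightarrow> ('b, 'l) ring_scheme \<Rightarrow> ('a \<Rightarrow> 'b) \<Rightarrow> bool" where
  "finite_type_hom R T h \<longleftrightarrow> h \<in> chom R T \<and>
     (\<exists>n. \<exists>x \<in> {..<n} \<rightarrow> carrier T.
        mpoly_eval R T h x ` carrier (mpoly_ring R n) = carrier T)"

definition finite_presentation_hom ::
    "('a, 'k) ring_scheme \<Rightarrow> ('b, 'l) ring_scheme \<Rightarrow> ('a \<Rightarrow> 'b) \<Rightarrow> bool" where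
  "finite_presentation_hom R T h \<longleftrightarrow> h \<in> chom R T \<and>
     (\<exists>n. \<exists>x \<in> {..<n} \<rightarrow> carrier T.
        mpoly_eval R T h x ` carrier (mpoly_ring R n) = carrier T \<and>
        (\<exists>F. finite F \<and> F \<subseteq> carrier (mpoly_ring R n) \<and>
           {p \<in> carrier (mpoly_ring R n). mpoly_eval R T h x p = \<zero>\<^bsub>T\<^esub>}
             = genideal (mpoly_ring R n) F))"

text \<open>Unique lifting of \<open>T \<rightarrow> D\<close> along surjections \<open>p : C \<rightarrow> D\<close> with square-zero kernel.\<close>

definition formally_etale :: "'a ring \<Rightarrow> 'a ring \<Rightarrow> ('a \<Rightarrow> 'a) \<Rightarrow> bool" where
  "formally_etale R T h \<longleftrightarrow> h \<in> chom R T \<and>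
     (\<forall>(C::'a ring) (D::'a ring) p a b.
        cring C \<and> cring D \<and> p \<in> chom C D \<and> p ` carrier C = carrier D \<and>
        (\<forall>x\<in>a_kernel C D p. \<forall>y\<in>a_kernel C D p. x \<otimes>\<^bsub>C\<^esub> y = \<zero>\<^bsub>C\<^esub>) \<and>
        a \<in> chom R C \<and> b \<in> chom T D \<and>
        compose (carrier R) b h = compose (carrier R) p a \<longrightarrow>
        (\<exists>!c. c \<in> chom T C \<and> compose (carrier R) c h = a \<and> compose (carrier T) p c = b))"

definition etale :: "'a ring \<Rightarrow> 'a ring \<Rightarrow> ('a \<Rightarrow> 'a) \<Rightarrow> bool" where
  "etale R T h \<longleftrightarrow> finite_presentation_hom R T h \<and> formally_etale R T h"

text \<open>\<open>{Spec T \<rightarrow> Spec R}\<^bsub>(T, h) \<in> K\<^esub>\<close> is jointly surjective.\<close>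

definition jointly_surjective :: "'a ring \<Rightarrow> ('a ring \<times> ('a \<Rightarrow> 'a)) set \<Rightarrow> bool" where
  "jointly_surjective R K \<longleftrightarrow>
     (\<forall>P. primeideal P R \<longrightarrow>
        (\<exists>(T, h)\<in>K. \<exists>Q. primeideal Q T \<and> P = {r \<in> carrier R. h r \<in> Q}))"

definition etale_covering :: "'a ring \<Rightarrow> ('a ring \<times> ('a \<Rightarrow> 'a)) set \<Rightarrow> bool" where
  "etale_covering R K \<longleftrightarrow> (\<forall>(T, h)\<in>K. cring T \<and> etale R T h) \<and> jointly_surjective R K"

definition zariski_covering :: "'a ring \<Rightarrow> ('a ring \<times> ('a \<Rightarrow> 'a)) set \<Rightarrow> bool" where
  "zariski_covering R K \<longleftrightarrow>
     (\<forall>(T, h)\<in>K. cring T \<and>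
        (\<exists>s\<in>carrier R. is_localization R (range (\<lambda>n::nat. s [^]\<^bsub>R\<^esub> n)) T h)) \<and>
     jointly_surjective R K"


section \<open>Schemes and algebraic spaces as functors of points\<close>

text \<open>A presheaf of sets on affine schemes, i.e. a covariant functor on commutative rings.\<close>

record ('a, 's) psh =
  pts :: "'a ring \<Rightarrow> 's set"
  pmap :: "'a ring \<Rightarrow> 'a ring \<Rightarrow> ('a \<Rightarrow> 'a) \<Rightarrow> 's \<Rightarrow> 's"

definition presheaf :: "('a, 's) psh \<Rightarrow> bool" where
  "presheaf F \<longleftrightarrow>
     (\<forall>R T h x. cring R \<and> cring T \<and> h \<in> chom R T \<and> x \<in> pts F R \<longrightarrow> pmap F R T h x \<in> pts F T) \<and>
     (\<forall>R x. cring R \<and> x \<in> pts F R \<longrightarrow> pmap F R R (idhom R) x = x) \<and>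
     (\<forall>R T U h k x. cring R \<and> cring T \<and> cring U \<and> h \<in> chom R T \<and> k \<in> chom T U \<and> x \<in> pts F R \<longrightarrow>
        pmap F R U (compose (carrier R) k h) x = pmap F T U k (pmap F R T h x))"

text \<open>
  In the sheaf condition, compatibility on the fibre product of two members of the covering is
  tested on all affine schemes mapping to it.
\<close>

definition sheaf ::
    "('a ring \<Rightarrow> ('a ring \<times> ('a \<Rightarrow> 'a)) set \<Rightarrow> bool) \<Rightarrow> ('a, 's) psh \<Rightarrow> bool" where
  "sheaf cov F \<longleftrightarrow> presheaf F \<and>
     (\<forall>R K (s :: 'a ring \<times> ('a \<Rightarrow> 'a) \<Rightarrow> 's).
        cring R \<and> cov R K \<and> (\<forall>(T, h)\<in>K. s (T, h) \<in> pts F T) \<and>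
        (\<forall>(T1, h1)\<in>K. \<forall>(T2, h2)\<in>K. \<forall>U. \<forall>k1\<in>chom T1 U. \<forall>k2\<in>chom T2 U.
           cring U \<and> compose (carrier R) k1 h1 = compose (carrier R) k2 h2 \<longrightarrow>
           pmap F T1 U k1 (s (T1, h1)) = pmap F T2 U k2 (s (T2, h2))) \<longrightarrow>
        (\<exists>!x. x \<in> pts F R \<and> (\<forall>(T, h)\<in>K. pmap F R T h x = s (T, h))))"

text \<open>
  By Yoneda, a morphism \<open>Spec U \<rightarrow> F\<close> is a point \<open>u \<in> F(U)\<close>. It is an open immersion if for every
  \<open>Spec R \<rightarrow> F\<close> the base change \<open>Spec U \<times>\<^sub>F Spec R \<rightarrow> Spec R\<close> is a monomorphism whose image is the
  open subscheme complementary to \<open>V(I)\<close>, for some ideal \<open>I\<close> of \<open>R\<close>; a morphism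
  \<open>h : Spec T \<rightarrow> Spec R\<close> factors through the latter iff \<open>I T = T\<close>.
\<close>

definition affine_open :: "('a, 's) psh \<Rightarrow> 'a ring \<Rightarrow> 's \<Rightarrow> bool" where
  "affine_open F U u \<longleftrightarrow> cring U \<and> u \<in> pts F U \<and>
     (\<forall>T. cring T \<longrightarrow> inj_on (\<lambda>k. pmap F U T k u) (chom U T)) \<and>
     (\<forall>R x. cring R \<and> x \<in> pts F R \<longrightarrow>
        (\<exists>I. ideal I R \<and>
           (\<forall>T h. cring T \<and> h \<in> chom R T \<longrightarrow>
              (\<exists>k\<in>chom U T. pmap F U T k u = pmap F R T h x)
                \<longleftrightarrow> genideal T (h ` I) = carrier T)))"

text \<open>A family of open immersions into \<open>F\<close> is a covering iff it is surjective on field-valued points.\<close>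

definition affine_open_cover :: "('a, 's) psh \<Rightarrow> ('a ring \<times> 's) set \<Rightarrow> bool" where
  "affine_open_cover F C \<longleftrightarrow> (\<forall>(U, u)\<in>C. affine_open F U u) \<and>
     (\<forall>K x. field K \<and> x \<in> pts F K \<longrightarrow> (\<exists>(U, u)\<in>C. \<exists>k\<in>chom U K. pmap F U K k u = x))"

definition scheme :: "('a, 's) psh \<Rightarrow> bool" where
  "scheme F \<longleftrightarrow> sheaf zariski_covering F \<and> (\<exists>C. affine_open_cover F C)"

text \<open>\<open>Spec R \<times>\<^sub>F Spec T\<close> for \<open>u : Spec R \<rightarrow> F\<close> and \<open>v : Spec T \<rightarrow> F\<close>.\<close>

definition fibre_prod ::
    "('a, 's) psh \<Rightarrow> 'a ring \<Rightarrow> 's \<Rightarrow> 'a ring \<Rightarrow> 's \<Rightarrow> ('a, ('a \<Rightarrow> 'a) \<times> ('a \<Rightarrow> 'a)) psh" where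
  "fibre_prod F R u T v =
     \<lparr>pts = (\<lambda>A. {(h, k). h \<in> chom R A \<and> k \<in> chom T A \<and> pmap F R A h u = pmap F T A k v}),
      pmap = (\<lambda>A A' c (h, k). (compose (carrier R) c h, compose (carrier T) c k))\<rparr>"

text \<open>The base change of the diagonal \<open>F \<rightarrow> F \<times> F\<close> along \<open>(a, b) : Spec R \<rightarrow> F \<times> F\<close>.\<close>

definition equalizer :: "('a, 's) psh \<Rightarrow> 'a ring \<Rightarrow> 's \<Rightarrow> 's \<Rightarrow> ('a, 'a \<Rightarrow> 'a) psh" where
  "equalizer F R a b =
     \<lparr>pts = (\<lambda>A. {h \<in> chom R A. pmap F R A h a = pmap F R A h b}),
      pmap = (\<lambda>A A' c h. compose (carrier R) c h)\<rparr>"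

text \<open>
  An etale surjection onto \<open>F\<close> from the scheme \<open>U\<close>, the disjoint union of the \<open>Spec R\<close> with
  \<open>(R, u) \<in> E\<close>. Etaleness of the projection \<open>Spec R \<times>\<^sub>F Spec T \<rightarrow> Spec T\<close> is tested on the affine
  opens of its source.
\<close>

definition etale_atlas :: "('a, 's) psh \<Rightarrow> ('a ring \<times> 's) set \<Rightarrow> bool" where
  "etale_atlas F E \<longleftrightarrow>
     (\<forall>(R, u)\<in>E. cring R \<and> u \<in> pts F R \<and>
        (\<forall>T v C h k. cring T \<and> v \<in> pts F T \<and> affine_open (fibre_prod F R u T v) C (h, k)
           \<longrightarrow> etale T C k)) \<and>
     (\<forall>K x. field K \<and> x \<in> pts F K \<longrightarrow>
        (\<exists>L. \<exists>i\<in>chom K L. \<exists>(R, u)\<in>E. \<exists>h\<in>chom R L.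
           field L \<and> pmap F R L h u = pmap F K L i x))"

definition locally_noetherian_algebraic_space :: "('a, 's) psh \<Rightarrow> bool" where
  "locally_noetherian_algebraic_space F \<longleftrightarrow>
     sheaf etale_covering F \<and>
     (\<forall>R. \<forall>a\<in>pts F R. \<forall>b\<in>pts F R. cring R \<longrightarrow> scheme (equalizer F R a b)) \<and>
     (\<exists>E. etale_atlas F E \<and> (\<forall>(R, u)\<in>E. noetherian_ring R))"


section \<open>Algebras over the base\<close>

text \<open>An \<open>\<O>\<^sub>S\<close>-algebra is a ring \<open>A\<close> together with a morphism \<open>Spec A \<rightarrow> S\<close>, i.e. a point of \<open>S(A)\<close>.\<close>

record ('a, 's) salg = "'a ring" +
  str :: 's

definition is_salg :: "('a, 's) psh \<Rightarrow> ('a, 's) salg \<Rightarrow> bool" where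
  "is_salg S A \<longleftrightarrow> cring A \<and> str A \<in> pts S (ring.truncate A)"

definition shom :: "('a, 's) psh \<Rightarrow> ('a, 's) salg \<Rightarrow> ('a, 's) salg \<Rightarrow> ('a \<Rightarrow> 'a) set" where
  "shom S A B =
     {h \<in> chom A B. pmap S (ring.truncate A) (ring.truncate B) h (str A) = str B}"

text \<open>
  \<open>Spec B \<rightarrow> S\<close> is of finite type (in particular quasi-compact), tested after base change to each
  affine scheme over \<open>S\<close>.
\<close>

definition finite_type_over :: "('a, 's) psh \<Rightarrow> ('a, 's) salg \<Rightarrow> bool" where
  "finite_type_over S B \<longleftrightarrow>
     (\<forall>T. \<forall>t\<in>pts S T. cring T \<longrightarrow>
        (\<exists>C. finite C \<and> affine_open_cover (fibre_prod S (ring.truncate B) (str B) T t) C \<and>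
           (\<forall>(U, h, k)\<in>C. finite_type_hom T U k)))"


section \<open>Stacks in groupoids\<close>

text \<open>
  A category with a functor to \<open>(Aff/S)\<close>. An object \<open>x\<close> lies over \<open>Spec (base x)\<close>; an arrow
  \<open>m : x \<rightarrow> y\<close> lies over the morphism \<open>Spec (base x) \<rightarrow> Spec (base y)\<close> given by the homomorphism
  \<open>bmap m : base y \<rightarrow> base x\<close>. The composite of \<open>n\<close> after \<open>m\<close> is \<open>cmp n m\<close>.
\<close>

record ('a, 's, 'o, 'm) cat =
  Ob :: "'o set"
  Ar :: "'m set"
  src :: "'m \<Rightarrow> 'o"
  trg :: "'m \<Rightarrow> 'o"
  idn :: "'o \<Rightarrow> 'm"
  cmp :: "'m \<Rightarrow> 'm \<Rightarrow> 'm"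
  base :: "'o \<Rightarrow> ('a, 's) salg"
  bmap :: "'m \<Rightarrow> 'a \<Rightarrow> 'a"

definition arr :: "('a, 's, 'o, 'm) cat \<Rightarrow> 'm \<Rightarrow> 'o \<Rightarrow> 'o \<Rightarrow> ('a \<Rightarrow> 'a) \<Rightarrow> bool" where
  "arr X m x y h \<longleftrightarrow> m \<in> Ar X \<and> src X m = x \<and> trg X m = y \<and> bmap X m = h"

locale category_over =
  fixes S :: "('a, 's) psh" and X :: "('a, 's, 'o, 'm) cat"
  assumes base_salg: "x \<in> Ob X \<Longrightarrow> is_salg S (base X x)"
    and src_Ob: "m \<in> Ar X \<Longrightarrow> src X m \<in> Ob X"
    and trg_Ob: "m \<in> Ar X \<Longrightarrow> trg X m \<in> Ob X"
    and bmap_shom: "m \<in> Ar X \<Longrightarrow> bmap X m \<in> shom S (base X (trg X m)) (base X (src X m))"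
    and idn_arr: "x \<in> Ob X \<Longrightarrow> arr X (idn X x) x x (idhom (base X x))"
    and cmp_arr: "\<lbrakk>m \<in> Ar X; n \<in> Ar X; trg X m = src X n\<rbrakk> \<Longrightarrow>
      arr X (cmp X n m) (src X m) (trg X n)
        (compose (carrier (base X (trg X n))) (bmap X m) (bmap X n))"
    and cmp_idn: "m \<in> Ar X \<Longrightarrow> cmp X m (idn X (src X m)) = m"
    and idn_cmp: "m \<in> Ar X \<Longrightarrow> cmp X (idn X (trg X m)) m = m"
    and cmp_assoc: "\<lbrakk>l \<in> Ar X; m \<in> Ar X; n \<in> Ar X; trg X l = src X m; trg X m = src X n\<rbrakk> \<Longrightarrow>
      cmp X n (cmp X m l) = cmp X (cmp X n m) l"

locale fibred_in_groupoids = category_over +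
  assumes pullback_exists: "\<lbrakk>y \<in> Ob X; is_salg S A; h \<in> shom S (base X y) A\<rbrakk> \<Longrightarrow>
      \<exists>x\<in>Ob X. base X x = A \<and> (\<exists>m. arr X m x y h)"
    and cartesian: "\<lbrakk>m \<in> Ar X; n \<in> Ar X; trg X n = trg X m;
      h \<in> shom S (base X (src X m)) (base X (src X n));
      bmap X n = compose (carrier (base X (trg X m))) h (bmap X m)\<rbrakk> \<Longrightarrow>
      \<exists>!l. arr X l (src X n) (src X m) h \<and> cmp X m l = n"

definition fibre_iso :: "('a, 's, 'o, 'm) cat \<Rightarrow> 'm \<Rightarrow> 'o \<Rightarrow> 'o \<Rightarrow> bool" where
  "fibre_iso X m x y \<longleftrightarrow> arr X m x y (idhom (base X x)) \<and> base X x = base X y \<and>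
     (\<exists>n. arr X n y x (idhom (base X y)) \<and> cmp X n m = idn X x \<and> cmp X m n = idn X y)"

text \<open>The sieve on \<open>Spec B\<close> generated by the covering \<open>K\<close>.\<close>

definition sieve ::
    "('a, 's) psh \<Rightarrow> ('a, 's) salg \<Rightarrow> ('a ring \<times> ('a \<Rightarrow> 'a)) set
      \<Rightarrow> (('a, 's) salg \<times> ('a \<Rightarrow> 'a)) set" where
  "sieve S B K = {(T, g). is_salg S T \<and> g \<in> shom S B T \<and>
     (\<exists>(C, h)\<in>K. \<exists>k\<in>chom C T. g = compose (carrier B) k h)}"

text \<open>
  Descent without a chosen cleavage: for every covering sieve of \<open>Spec B\<close>, restriction of
  cartesian functors from \<open>(Aff/Spec B)\<close> to the sieve is an equivalence. Full faithfulness says that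
  isomorphisms \<open>x \<rightarrow> y\<close> over \<open>Spec B\<close> form a sheaf; essential surjectivity says that every descent
  datum, i.e. a functor \<open>(D, M)\<close> from the sieve to \<open>X\<close> over \<open>(Aff/S)\<close>, is effective. Here
  \<open>M T g U k\<close> is the arrow \<open>D U (k g) \<rightarrow> D T g\<close> over \<open>k : T \<rightarrow> U\<close>.
\<close>

locale stack = fibred_in_groupoids +
  assumes isoms_sheaf: "\<lbrakk>is_salg S B; etale_covering (ring.truncate B) K;
      x \<in> Ob X; y \<in> Ob X; base X x = B; base X y = B;
      \<And>a. \<lbrakk>a \<in> Ar X; trg X a = x; (base X (src X a), bmap X a) \<in> sieve S B K\<rbrakk> \<Longrightarrow>
        arr X (u a) (src X a) y (bmap X a);
      \<And>a b. \<lbrakk>a \<in> Ar X; trg X a = x; (base X (src X a), bmap X a) \<in> sieve S B K;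
         b \<in> Ar X; trg X b = src X a\<rbrakk> \<Longrightarrow> u (cmp X a b) = cmp X (u a) b\<rbrakk> \<Longrightarrow>
      \<exists>!k. arr X k x y (idhom B) \<and>
        (\<forall>a\<in>Ar X. trg X a = x \<and> (base X (src X a), bmap X a) \<in> sieve S B K \<longrightarrow> u a = cmp X k a)"
    and descent_effective: "\<lbrakk>is_salg S B; etale_covering (ring.truncate B) K;
      \<And>T g. (T, g) \<in> sieve S B K \<Longrightarrow> D T g \<in> Ob X \<and> base X (D T g) = T;
      \<And>T g U k. \<lbrakk>(T, g) \<in> sieve S B K; is_salg S U; k \<in> shom S T U\<rbrakk> \<Longrightarrow>
        arr X (M T g U k) (D U (compose (carrier B) k g)) (D T g) k;
      \<And>T g. (T, g) \<in> sieve S B K \<Longrightarrow> M T g T (idhom T) = idn X (D T g);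
      \<And>T g U k V l. \<lbrakk>(T, g) \<in> sieve S B K; is_salg S U; k \<in> shom S T U; is_salg S V; l \<in> shom S U V\<rbrakk> \<Longrightarrow>
        M T g V (compose (carrier T) l k)
          = cmp X (M T g U k) (M U (compose (carrier B) k g) V l)\<rbrakk> \<Longrightarrow>
      \<exists>x\<in>Ob X. base X x = B \<and>
        (\<exists>c. (\<forall>(T, g)\<in>sieve S B K. arr X (c T g) (D T g) x g) \<and>
             (\<forall>(T, g)\<in>sieve S B K. \<forall>U. \<forall>k\<in>shom S T U. is_salg S U \<longrightarrow>
                cmp X (c T g) (M T g U k) = c U (compose (carrier B) k g)))"

text \<open>1-morphisms: functors over \<open>(Aff/S)\<close>.\<close>

record ('o, 'm, 'p, 'n) morph =
  obj :: "'o \<Rightarrow> 'p"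
  mor :: "'m \<Rightarrow> 'n"

definition one_morphism ::
    "('a, 's, 'o, 'm) cat \<Rightarrow> ('a, 's, 'p, 'n) cat \<Rightarrow> ('o, 'm, 'p, 'n) morph \<Rightarrow> bool" where
  "one_morphism X Y f \<longleftrightarrow>
     (\<forall>x\<in>Ob X. obj f x \<in> Ob Y \<and> base Y (obj f x) = base X x \<and>
        mor f (idn X x) = idn Y (obj f x)) \<and>
     (\<forall>m\<in>Ar X. arr Y (mor f m) (obj f (src X m)) (obj f (trg X m)) (bmap X m)) \<and>
     (\<forall>m\<in>Ar X. \<forall>n\<in>Ar X. trg X m = src X n \<longrightarrow> mor f (cmp X n m) = cmp Y (mor f n) (mor f m))"

definition morph_comp ::
    "('p, 'n, 'q, 'l) morph \<Rightarrow> ('o, 'm, 'p, 'n) morph \<Rightarrow> ('o, 'm, 'q, 'l) morph" where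
  "morph_comp f e = \<lparr>obj = obj f \<circ> obj e, mor = mor f \<circ> mor e\<rparr>"


section \<open>Deformation situations and lifts\<close>

definition infinitesimal_extension ::
    "('a, 's) psh \<Rightarrow> ('a, 's) salg \<Rightarrow> ('a, 's) salg \<Rightarrow> ('a \<Rightarrow> 'a) \<Rightarrow> bool" where
  "infinitesimal_extension S B' B q \<longleftrightarrow>
     is_salg S B' \<and> is_salg S B \<and> noetherian_ring B' \<and> noetherian_ring B \<and>
     q \<in> shom S B' B \<and> q ` carrier B' = carrier B \<and> nilpotent_ideal B' (a_kernel B' B q)"

text \<open>The extension pair \<open>B' \<rightarrow> B \<rightarrow> B\<^sub>0\<close> is \<open>big \<rightarrow> mid \<rightarrow> red\<close>, with maps \<open>ext\<close> and \<open>ext0\<close>.\<close>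

record ('a, 's) extpair =
  big :: "('a, 's) salg"
  mid :: "('a, 's) salg"
  red :: "('a, 's) salg"
  ext :: "'a \<Rightarrow> 'a"
  ext0 :: "'a \<Rightarrow> 'a"

definition extension_pair :: "('a, 's) psh \<Rightarrow> ('a, 's, 'z) extpair_scheme \<Rightarrow> bool" where
  "extension_pair S P \<longleftrightarrow>
     infinitesimal_extension S (big P) (mid P) (ext P) \<and>
     infinitesimal_extension S (mid P) (red P) (ext0 P) \<and>
     reduced (red P) \<and>
     (\<forall>x\<in>a_kernel (big P) (mid P) (ext P). \<forall>y\<in>a_kernel (big P) (red P) (ext0 P \<circ> ext P).
        x \<otimes>\<^bsub>big P\<^esub> y = \<zero>\<^bsub>big P\<^esub>)"

text \<open>
  In a category fibred in groupoids every arrow is cartesian, so the restriction \<open>a|\<^sub>B\<close> of an object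
  \<open>a\<close> over \<open>Spec A\<close> along \<open>A \<rightarrow> B\<close> is an object over \<open>Spec B\<close> with an arrow to \<open>a\<close> over
  \<open>Spec B \<rightarrow> Spec A\<close>; it is unique up to unique isomorphism. No cleavage is fixed; instead
  the restrictions that occur are carried along as data, together with their arrows.

  In a deformation situation, \<open>yobj\<close> is \<open>b'\<^sub>Y\<close>, \<open>xobj\<close> is \<open>b\<^sub>X\<close>, \<open>yres\<close> is \<open>b'\<^sub>Y|\<^sub>B\<close> with arrow
  \<open>yarr\<close> to \<open>b'\<^sub>Y\<close>, and \<open>siso\<close> is the isomorphism \<open>f(b\<^sub>X) \<rightarrow> b'\<^sub>Y|\<^sub>B\<close>.
\<close>

record ('a, 's, 'o, 'p, 'n) situation = "('a, 's) extpair" +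
  yobj :: 'p
  xobj :: 'o
  yres :: 'p
  yarr :: 'n
  siso :: 'n

definition deformation_situation ::
    "('a, 's) psh \<Rightarrow> ('a, 's, 'o, 'm) cat \<Rightarrow> ('a, 's, 'p, 'n) cat \<Rightarrow> ('o, 'm, 'p, 'n) morph
      \<Rightarrow> ('a, 's, 'o, 'p, 'n) situation \<Rightarrow> bool" where
  "deformation_situation S X Y f D \<longleftrightarrow>
     extension_pair S D \<and>
     yobj D \<in> Ob Y \<and> base Y (yobj D) = big D \<and>
     xobj D \<in> Ob X \<and> base X (xobj D) = mid D \<and>
     yres D \<in> Ob Y \<and> base Y (yres D) = mid D \<and>
     arr Y (yarr D) (yres D) (yobj D) (ext D) \<and>
     fibre_iso Y (siso D) (obj f (xobj D)) (yres D)"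

definition integral_situation :: "('a, 's, 'z) extpair_scheme \<Rightarrow> bool" where
  "integral_situation D \<longleftrightarrow> domain (red D)"

definition algebraic_situation :: "('a, 's) psh \<Rightarrow> ('a, 's, 'z) extpair_scheme \<Rightarrow> bool" where
  "algebraic_situation S D \<longleftrightarrow> finite_type_over S (red D)"

text \<open>
  In a lift, \<open>lobj\<close> is \<open>b'\<^sub>X\<close>, \<open>lres\<close> is \<open>b'\<^sub>X|\<^sub>B\<close> with arrow \<open>larr\<close> to \<open>b'\<^sub>X\<close>, and \<open>lxiso\<close>,
  \<open>lyiso\<close> are the isomorphisms \<open>b'\<^sub>X|\<^sub>B \<rightarrow> b\<^sub>X\<close> and \<open>f(b'\<^sub>X) \<rightarrow> b'\<^sub>Y\<close>. Compatibility, that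
  \<open>f(b'\<^sub>X)|\<^sub>B = f(b'\<^sub>X|\<^sub>B) \<rightarrow> f(b\<^sub>X) \<rightarrow> b'\<^sub>Y|\<^sub>B\<close> is the restriction of \<open>lyiso\<close>, is stated after
  composing with the cartesian arrow \<open>b'\<^sub>Y|\<^sub>B \<rightarrow> b'\<^sub>Y\<close>.
\<close>

record ('o, 'm, 'n) lift =
  lobj :: 'o
  lres :: 'o
  larr :: 'm
  lxiso :: 'm
  lyiso :: 'n

definition is_lift ::
    "('a, 's, 'o, 'm) cat \<Rightarrow> ('a, 's, 'p, 'n) cat \<Rightarrow> ('o, 'm, 'p, 'n) morph
      \<Rightarrow> ('a, 's, 'o, 'p, 'n) situation \<Rightarrow> ('o, 'm, 'n) lift \<Rightarrow> bool" where
  "is_lift X Y f D L \<longleftrightarrow>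
     lobj L \<in> Ob X \<and> base X (lobj L) = big D \<and>
     lres L \<in> Ob X \<and> base X (lres L) = mid D \<and>
     arr X (larr L) (lres L) (lobj L) (ext D) \<and>
     fibre_iso X (lxiso L) (lres L) (xobj D) \<and>
     fibre_iso Y (lyiso L) (obj f (lobj L)) (yobj D) \<and>
     cmp Y (yarr D) (cmp Y (siso D) (mor f (lxiso L))) = cmp Y (lyiso L) (mor f (larr L))"

text \<open>A morphism (commutative diagram) of extension pairs from \<open>P\<close> to \<open>Q\<close>.\<close>

definition pair_map ::
    "('a, 's) psh \<Rightarrow> ('a, 's, 'y) extpair_scheme \<Rightarrow> ('a, 's, 'z) extpair_scheme
      \<Rightarrow> ('a \<Rightarrow> 'a) \<Rightarrow> ('a \<Rightarrow> 'a) \<Rightarrow> ('a \<Rightarrow> 'a) \<Rightarrow> bool" where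
  "pair_map S P Q h' h h0 \<longleftrightarrow>
     h' \<in> shom S (big P) (big Q) \<and> h \<in> shom S (mid P) (mid Q) \<and> h0 \<in> shom S (red P) (red Q) \<and>
     compose (carrier (big P)) (ext Q) h' = compose (carrier (big P)) h (ext P) \<and>
     compose (carrier (mid P)) (ext0 Q) h = compose (carrier (mid P)) h0 (ext0 P)"

text \<open>
  \<open>D2\<close> is the base change of \<open>D1\<close> along \<open>(h', h, h0)\<close>: the arrows \<open>v\<close> and \<open>w\<close> exhibit \<open>yobj D2\<close> and
  \<open>xobj D2\<close> as restrictions of \<open>yobj D1\<close> and \<open>xobj D1\<close>, and the isomorphism of \<open>D2\<close> is the one
  induced by that of \<open>D1\<close>.
\<close>

definition is_base_change ::
    "('a, 's) psh \<Rightarrow> ('a, 's, 'o, 'm) cat \<Rightarrow> ('a, 's, 'p, 'n) cat \<Rightarrow> ('o, 'm, 'p, 'n) morph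
      \<Rightarrow> ('a, 's, 'o, 'p, 'n) situation \<Rightarrow> ('a, 's, 'o, 'p, 'n) situation
      \<Rightarrow> ('a \<Rightarrow> 'a) \<Rightarrow> ('a \<Rightarrow> 'a) \<Rightarrow> ('a \<Rightarrow> 'a) \<Rightarrow> 'n \<Rightarrow> 'm \<Rightarrow> bool" where
  "is_base_change S X Y f D1 D2 h' h h0 v w \<longleftrightarrow>
     deformation_situation S X Y f D1 \<and> deformation_situation S X Y f D2 \<and>
     pair_map S D1 D2 h' h h0 \<and>
     arr Y v (yobj D2) (yobj D1) h' \<and> arr X w (xobj D2) (xobj D1) h \<and>
     cmp Y v (cmp Y (yarr D2) (siso D2)) = cmp Y (yarr D1) (cmp Y (siso D1) (mor f w))"

text \<open>
  The lift \<open>L2\<close> of \<open>D2\<close> is the base change of the lift \<open>L1\<close> of \<open>D1\<close>, where \<open>D2\<close> is the base change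
  of \<open>D1\<close> via \<open>v\<close> and \<open>w\<close>: the arrow \<open>g\<close> exhibits \<open>lobj L2\<close> as a restriction of \<open>lobj L1\<close>, and the
  isomorphisms of \<open>L2\<close> are induced by those of \<open>L1\<close>.
\<close>

definition is_lift_base_change ::
    "('a, 's, 'o, 'm) cat \<Rightarrow> ('a, 's, 'p, 'n) cat \<Rightarrow> ('o, 'm, 'p, 'n) morph
      \<Rightarrow> ('o, 'm, 'n) lift \<Rightarrow> ('o, 'm, 'n) lift \<Rightarrow> ('a \<Rightarrow> 'a) \<Rightarrow> ('a \<Rightarrow> 'a) \<Rightarrow> 'n \<Rightarrow> 'm \<Rightarrow> 'm \<Rightarrow> bool"
  where
  "is_lift_base_change X Y f L1 L2 h' h v w g \<longleftrightarrow>
     arr X g (lobj L2) (lobj L1) h' \<and>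
     cmp Y v (lyiso L2) = cmp Y (lyiso L1) (mor f g) \<and>
     (\<exists>r. arr X r (lres L2) (lres L1) h \<and>
        cmp X (larr L1) r = cmp X g (larr L2) \<and>
        cmp X w (lxiso L2) = cmp X (lxiso L1) r)"

text \<open>
  \<open>Q\<close> is the localization of the extension pair \<open>P\<close> at the generic point of \<open>Spec B\<^sub>0\<close>: the three
  rings are localized at the elements with nonzero image in \<open>B\<^sub>0\<close>, so \<open>red Q = Frac B\<^sub>0\<close>.
\<close>

definition generic_pair ::
    "('a, 's) psh \<Rightarrow> ('a, 's, 'y) extpair_scheme \<Rightarrow> ('a, 's, 'z) extpair_scheme
      \<Rightarrow> ('a \<Rightarrow> 'a) \<Rightarrow> ('a \<Rightarrow> 'a) \<Rightarrow> ('a \<Rightarrow> 'a) \<Rightarrow> bool" where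
  "generic_pair S P Q l' l l0 \<longleftrightarrow> pair_map S P Q l' l l0 \<and>
     is_localization (big P) {b \<in> carrier (big P). ext0 P (ext P b) \<noteq> \<zero>\<^bsub>red P\<^esub>} (big Q) l' \<and>
     is_localization (mid P) {b \<in> carrier (mid P). ext0 P b \<noteq> \<zero>\<^bsub>red P\<^esub>} (mid Q) l \<and>
     is_localization (red P) (carrier (red P) - {\<zero>\<^bsub>red P\<^esub>}) (red Q) l0"

text \<open>
  \<open>L\<close> is a generic lift of \<open>D\<close>, i.e. a lift of the base change \<open>G\<close> of \<open>D\<close> to \<open>(A' \<rightarrow> A \<rightarrow> A\<^sub>0)\<close>.
\<close>

definition generic_lift ::
    "('a, 's) psh \<Rightarrow> ('a, 's, 'o, 'm) cat \<Rightarrow> ('a, 's, 'p, 'n) cat \<Rightarrow> ('o, 'm, 'p, 'n) morph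
      \<Rightarrow> ('a, 's, 'o, 'p, 'n) situation \<Rightarrow> ('a, 's, 'o, 'p, 'n) situation
      \<Rightarrow> ('a \<Rightarrow> 'a) \<Rightarrow> ('a \<Rightarrow> 'a) \<Rightarrow> ('a \<Rightarrow> 'a) \<Rightarrow> 'n \<Rightarrow> 'm \<Rightarrow> ('o, 'm, 'n) lift \<Rightarrow> bool" where
  "generic_lift S X Y f D G l' l l0 v w L \<longleftrightarrow>
     generic_pair S D G l' l l0 \<and> is_base_change S X Y f D G l' l l0 v w \<and> is_lift X Y f G L"

text \<open>
  \<open>N\<close> lives over \<open>(B'\<^sub>n\<^sub>e\<^sub>w \<rightarrow> B \<rightarrow> B\<^sub>0)\<close> and is the base change of \<open>D\<close> along \<open>j : B' \<rightarrow> B'\<^sub>n\<^sub>e\<^sub>w\<close>. The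
  inclusion \<open>B'\<^sub>n\<^sub>e\<^sub>w \<subseteq> A' \<times>\<^sub>A B\<close> is given by its two components \<open>p\<close> and \<open>ext N\<close>; the latter is the
  projection to \<open>B\<close>, and \<open>B'\<^sub>n\<^sub>e\<^sub>w\<close> contains the image of \<open>B'\<close> because \<open>p j = l'\<close> and
  \<open>(ext N) j = ext D\<close>. The arrows \<open>v''\<close>, \<open>w''\<close> are the canonical ones that make \<open>G\<close> a base change
  of \<open>N\<close>.
\<close>

definition integral_lift ::
    "('a, 's) psh \<Rightarrow> ('a, 's, 'o, 'm) cat \<Rightarrow> ('a, 's, 'p, 'n) cat \<Rightarrow> ('o, 'm, 'p, 'n) morph
      \<Rightarrow> ('a, 's, 'o, 'p, 'n) situation \<Rightarrow> ('a, 's, 'o, 'p, 'n) situation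
      \<Rightarrow> ('a \<Rightarrow> 'a) \<Rightarrow> ('a \<Rightarrow> 'a) \<Rightarrow> ('a \<Rightarrow> 'a) \<Rightarrow> 'n \<Rightarrow> 'm \<Rightarrow> ('o, 'm, 'n) lift
      \<Rightarrow> ('a, 's, 'o, 'p, 'n) situation \<Rightarrow> ('o, 'm, 'n) lift \<Rightarrow> bool" where
  "integral_lift S X Y f D G l' l l0 v w L N LN \<longleftrightarrow>
     mid N = mid D \<and> red N = red D \<and> ext0 N = ext0 D \<and> is_lift X Y f N LN \<and>
     (\<exists>j p v' w' v'' w'' g.
        is_base_change S X Y f D N j (idhom (mid D)) (idhom (red D)) v' w' \<and>
        inj_on (\<lambda>b. (p b, ext N b)) (carrier (big N)) \<and>
        compose (carrier (big D)) p j = l' \<and>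
        is_base_change S X Y f N G p l l0 v'' w'' \<and>
        cmp Y v' v'' = v \<and> cmp X w' w'' = w \<and>
        is_lift_base_change X Y f LN L p l v'' w'' g)"

definition generic_lifts_integral ::
    "('a, 's) psh \<Rightarrow> ('a, 's, 'o, 'm) cat \<Rightarrow> ('a, 's, 'p, 'n) cat \<Rightarrow> ('o, 'm, 'p, 'n) morph
      \<Rightarrow> bool" where
  "generic_lifts_integral S X Y f \<longleftrightarrow>
     (\<forall>D. deformation_situation S X Y f D \<and> integral_situation D \<and> algebraic_situation S D \<longrightarrow>
        (\<forall>G l' l l0 v w L. generic_lift S X Y f D G l' l l0 v w L \<longrightarrow>
           (\<exists>N LN. integral_lift S X Y f D G l' l l0 v w L N LN)))"

end

theory Submission
  imports Defs
begin

text \<open>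
  The integral lift is built in two stages, first in \<open>X\<close> and then in \<open>W\<close>. The image under \<open>e\<close> of a
  generic lift \<open>L\<close> for \<open>f \<circ> e\<close> is a generic lift for \<open>f\<close>, so there are a ring \<open>B'\<^sub>1\<close> between \<open>B'\<close> and
  \<open>A' \<times>\<^sub>A B\<close> and a lift \<open>b'\<^sub>1\<close> over \<open>B'\<^sub>1\<close> with values in \<open>X\<close> which extends \<open>e(L)\<close>. Now take \<open>b'\<^sub>1\<close>
  for the target object of a deformation situation over \<open>e\<close>, with the given object of \<open>W\<close> over \<open>B\<close>:
  \<open>L\<close> is a generic lift of it, up to replacing its isomorphism to the target by an identity. It
  extends over a ring \<open>B'\<^sub>2\<close> between \<open>B'\<^sub>1\<close> and \<open>A' \<times>\<^sub>A B\<close>, and this extension is an integral lift of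
  \<open>L\<close> for \<open>f \<circ> e\<close>.

  For the second stage to apply, \<open>A'\<close> has to be the generic localization of \<open>B'\<^sub>1\<close> as well as of
  \<open>B'\<close>. This is the only ring-theoretic point (\<open>generic_pair_intermediate\<close>); it rests on the
  square-zero kernel of \<open>B'\<^sub>1 \<rightarrow> B\<close> and on the inclusion \<open>B'\<^sub>1 \<subseteq> A' \<times>\<^sub>A B\<close>.

  The rest is bookkeeping with isomorphisms. Situations are transported by three constructions:
  \<open>source_image\<close> applies \<open>e\<close> to the source object, \<open>lift_situation\<close> turns a lift for \<open>f\<close> into a situation
  over \<open>e\<close>, and \<open>target_image\<close> applies \<open>f\<close> to the target. The required base change relations between
  the resulting situations are then composites (\<open>base_change_trans\<close>) of
  \<open>D \<rightarrow> f(D\<^sub>2) \<rightarrow> f(N\<^sub>2) \<rightarrow> f(G\<^sub>2) \<rightarrow> G\<close>, where \<open>D\<^sub>2\<close>, \<open>G\<^sub>2\<close> are the situations over \<open>e\<close> made from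
  \<open>b'\<^sub>1\<close> and \<open>e(L)\<close>, \<open>N\<^sub>2\<close> comes from the second stage, and the two outer arrows
  (\<open>base_change_to_lift_situation\<close>, \<open>base_change_from_lift_situation\<close>) are the isomorphisms that
  belong to the lifts \<open>b'\<^sub>1\<close> and \<open>L\<close>.
\<close>

section \<open>Algebras and morphisms of extension pairs\<close>

lemma shomD:
  assumes "h \<in> shom S A B"
  shows "h \<in> ring_hom A B" "h \<in> extensional (carrier A)" "x \<in> carrier A \<Longrightarrow> h x \<in> carrier B"
  using assms by (auto simp: shom_def chom_def ring_hom_closed)

lemma compose_idhom_right:
  "h \<in> extensional (carrier A) \<Longrightarrow> compose (carrier A) h (idhom A) = h"
  by (auto simp: compose_def extensional_def fun_eq_iff)

lemma compose_idhom_left: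
  assumes "h \<in> shom S A B"
  shows "compose (carrier A) (idhom B) h = h"
  using shomD[OF assms] by (auto simp: compose_def extensional_def fun_eq_iff)

lemma compose_hom_assoc:
  assumes "f \<in> shom S A B"
  shows "compose (carrier A) h (compose (carrier A) g f) = compose (carrier A) (compose (carrier B) h g) f"
  using shomD(3)[OF assms] by (auto simp: compose_def fun_eq_iff)

lemma cring_truncate:
  assumes "cring A"
  shows "cring (ring.truncate A)"
proof -
  interpret cring A by fact
  show ?thesis
  proof (intro cringI abelian_groupI comm_monoidI)
    fix x assume "x \<in> carrier (ring.truncate A)"
    then show "\<exists>y\<in>carrier (ring.truncate A). y \<oplus>\<^bsub>ring.truncate A\<^esub> x = \<zero>\<^bsub>ring.truncate A\<^esub>"
      by (auto simp: ring.truncate_def intro!: bexI[of _ "\<ominus>\<^bsub>A\<^esub> x"] l_neg)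
  qed (auto simp: ring.truncate_def a_ac m_ac l_distr r_distr)
qed

lemma shom_compose:
  assumes S: "presheaf S" and A: "is_salg S A" and B: "is_salg S B" and C: "is_salg S C"
    and h: "h \<in> shom S A B" and k: "k \<in> shom S B C"
  shows "compose (carrier A) k h \<in> shom S A C"
proof -
  let ?t = ring.truncate
  have [simp]: "carrier (?t R) = carrier R" for R :: "('a, 's) salg"
    by (simp add: ring.truncate_def)
  have chom_t: "chom (?t R) (?t T) = chom R T" for R T :: "('a, 's) salg"
    by (simp add: chom_def ring_hom_def ring.truncate_def)
  have "compose (carrier A) k h \<in> chom A C"
  proof -
    interpret cring A using A by (simp add: is_salg_def)
    show ?thesis
      using h k by (auto simp: shom_def chom_def compose_def ring_hom_def Pi_iff)
  qed
  moreover have "pmap S (?t A) (?t C) (compose (carrier A) k h) (str A)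
      = pmap S (?t B) (?t C) k (pmap S (?t A) (?t B) h (str A))"
    using S A B C h k cring_truncate unfolding presheaf_def is_salg_def shom_def chom_t
    by (smt (verit) \<open>\<And>R. carrier (?t R) = carrier R\<close> chom_t mem_Collect_eq)
  ultimately show ?thesis
    using h k by (simp add: shom_def)
qed

lemma salg_idhom:
  assumes "presheaf S" "is_salg S A"
  shows "idhom A \<in> shom S A A"
proof -
  have "idhom (ring.truncate A) = idhom A"
    by (simp add: ring.truncate_def)
  then have "pmap S (ring.truncate A) (ring.truncate A) (idhom A) (str A) = str A"
    using assms cring_truncate unfolding presheaf_def is_salg_def by metis
  moreover have "idhom A \<in> chom A A"
  proof -
    interpret cring A using assms(2) by (simp add: is_salg_def)
    show ?thesis by (auto simp: chom_def ring_hom_def)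
  qed
  ultimately show ?thesis by (simp add: shom_def)
qed

lemma extension_pairD:
  assumes "extension_pair S P"
  shows "is_salg S (big P)" "is_salg S (mid P)" "is_salg S (red P)"
    "cring (big P)" "cring (mid P)" "cring (red P)"
    "ext P \<in> shom S (big P) (mid P)" "ext0 P \<in> shom S (mid P) (red P)"
    "ext P ` carrier (big P) = carrier (mid P)"
  using assms by (auto simp: extension_pair_def infinitesimal_extension_def is_salg_def)

lemma pair_mapD:
  assumes "pair_map S P Q h' h h0"
  shows "b \<in> carrier (big P) \<Longrightarrow> ext Q (h' b) = h (ext P b)"
    "c \<in> carrier (mid P) \<Longrightarrow> ext0 Q (h c) = h0 (ext0 P c)"
proof -
  have 1: "compose (carrier (big P)) (ext Q) h' b = compose (carrier (big P)) h (ext P) b"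
    and 2: "compose (carrier (mid P)) (ext0 Q) h c = compose (carrier (mid P)) h0 (ext0 P) c" for b c
    using assms by (simp_all add: pair_map_def)
  show "b \<in> carrier (big P) \<Longrightarrow> ext Q (h' b) = h (ext P b)" using 1[of b] by (simp add: compose_def)
  show "c \<in> carrier (mid P) \<Longrightarrow> ext0 Q (h c) = h0 (ext0 P c)" using 2[of c] by (simp add: compose_def)
qed

lemma pair_map_trans:
  assumes S: "presheaf S"
    and P: "extension_pair S P" and Q: "extension_pair S Q" and R: "extension_pair S R"
    and PQ: "pair_map S P Q h' h h0" and QR: "pair_map S Q R k' k k0"
  shows "pair_map S P R (compose (carrier (big P)) k' h') (compose (carrier (mid P)) k h)
    (compose (carrier (red P)) k0 h0)"
proof -
  have h: "h' \<in> shom S (big P) (big Q)" "h \<in> shom S (mid P) (mid Q)" "h0 \<in> shom S (red P) (red Q)"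
    and k: "k' \<in> shom S (big Q) (big R)" "k \<in> shom S (mid Q) (mid R)" "k0 \<in> shom S (red Q) (red R)"
    using PQ QR by (simp_all add: pair_map_def)
  note e = shomD(3)[OF extension_pairD(7)[OF P]] shomD(3)[OF extension_pairD(8)[OF P]]
  have "compose (carrier (big P)) (ext R) (compose (carrier (big P)) k' h')
      = compose (carrier (big P)) (compose (carrier (mid P)) k h) (ext P)"
    using shomD(3)[OF h(1)] e pair_mapD(1)[OF PQ] pair_mapD(1)[OF QR]
    by (auto simp: compose_def fun_eq_iff)
  moreover have "compose (carrier (mid P)) (ext0 R) (compose (carrier (mid P)) k h)
      = compose (carrier (mid P)) (compose (carrier (red P)) k0 h0) (ext0 P)"
    using shomD(3)[OF h(2)] e pair_mapD(2)[OF PQ] pair_mapD(2)[OF QR]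
    by (auto simp: compose_def fun_eq_iff)
  ultimately show ?thesis
    using shom_compose[OF S _ _ _ h(1) k(1)] shom_compose[OF S _ _ _ h(2) k(2)]
      shom_compose[OF S _ _ _ h(3) k(3)] extension_pairD(1-3)[OF P] extension_pairD(1-3)[OF Q]
      extension_pairD(1-3)[OF R]
    unfolding pair_map_def by blast
qed

lemma pair_map_refl:
  assumes S: "presheaf S" and P: "extension_pair S P"
    and eq: "big Q = big P" "mid Q = mid P" "red Q = red P" "ext Q = ext P" "ext0 Q = ext0 P"
  shows "pair_map S P Q (idhom (big P)) (idhom (mid P)) (idhom (red P))"
  using salg_idhom[OF S] extension_pairD(1-3)[OF P] extension_pairD(7,8)[OF P]
  unfolding pair_map_def eq
  by (simp add: compose_idhom_left[of _ S] compose_idhom_right shomD(2)[of _ S])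


section \<open>Generic localization of an intermediate ring\<close>

text \<open>\<open>(u + x) (u - x) = u\<^sup>2\<close> is a unit.\<close>

lemma (in cring) unit_plus_square_zero:
  assumes "u \<in> Units R" "x \<in> carrier R" "x \<otimes> x = \<zero>"
  shows "u \<oplus> x \<in> Units R"
proof -
  have u: "u \<in> carrier R" using assms(1) by (rule Units_closed)
  have "(u \<oplus> x) \<otimes> (u \<ominus> x) = u \<otimes> u \<ominus> x \<otimes> x"
    using u assms(2) by algebra
  also have "\<dots> = u \<otimes> u"
    using u assms(3) by (simp add: a_minus_def)
  finally have "(u \<oplus> x) \<otimes> (u \<ominus> x) \<in> Units R"
    using assms(1) by simp
  then show ?thesis
    by (rule unit_factor) (use u assms(2) in auto)
qed

text \<open>
  \<open>A'\<close> is the generic localization of every ring \<open>B'\<^sub>n\<^sub>e\<^sub>w\<close> between \<open>B'\<close> and \<open>A' \<times>\<^sub>A B\<close>. Every element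
  of \<open>B'\<^sub>n\<^sub>e\<^sub>w\<close> is the sum of an element coming from \<open>B'\<close> and one of the kernel of \<open>B'\<^sub>n\<^sub>e\<^sub>w \<rightarrow> B\<close>, which
  has square zero; so a denominator of \<open>B'\<^sub>n\<^sub>e\<^sub>w\<close> becomes a unit plus an element of square zero in
  \<open>A'\<close>, hence a unit. Fractions need only denominators from \<open>B'\<close>. If two elements of \<open>B'\<^sub>n\<^sub>e\<^sub>w\<close> agree
  in \<open>A'\<close>, a multiplier that identifies their images in \<open>B\<close> lifts to \<open>B'\<^sub>n\<^sub>e\<^sub>w\<close>, and there it identifies
  the elements themselves, because \<open>B'\<^sub>n\<^sub>e\<^sub>w\<close> embeds into \<open>A' \<times>\<^sub>A B\<close>.
\<close>

lemma generic_pair_intermediate: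
  assumes gen: "generic_pair S D G l' l l0"
    and D: "extension_pair S D" and N: "extension_pair S N" and G: "extension_pair S G"
    and eq: "mid N = mid D" "red N = red D" "ext0 N = ext0 D"
    and j: "pair_map S D N j (idhom (mid D)) (idhom (red D))"
    and p: "pair_map S N G p l l0"
    and inj: "inj_on (\<lambda>b. (p b, ext N b)) (carrier (big N))"
    and pj: "compose (carrier (big D)) p j = l'"
  shows "generic_pair S N G p l l0"
proof -
  define T where "T = {b \<in> carrier (big N). ext0 N (ext N b) \<noteq> \<zero>\<^bsub>red N\<^esub>}"
  define U where "U = {b \<in> carrier (big D). ext0 D (ext D b) \<noteq> \<zero>\<^bsub>red D\<^esub>}"
  interpret BN: cring "big N" by (rule extension_pairD(4)[OF N])
  interpret B: cring "mid D" by (rule extension_pairD(5)[OF D])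
  interpret BG: cring "big G" by (rule extension_pairD(4)[OF G])
  interpret B0: cring "red D" by (rule extension_pairD(6)[OF D])
  have q: "ext N \<in> ring_hom (big N) (mid D)" and qs: "ext N ` carrier (big N) = carrier (mid D)"
    and q0: "ext0 D \<in> ring_hom (mid D) (red D)"
    using N eq by (auto simp: extension_pair_def infinitesimal_extension_def dest: shomD)
  interpret q: ring_hom_cring "big N" "mid D" "ext N"
    by unfold_locales (rule q)
  interpret q0: ring_hom_cring "mid D" "red D" "ext0 D"
    by unfold_locales (rule q0)
  have qDs: "ext D ` carrier (big D) = carrier (mid D)"
    using D by (auto simp: extension_pair_def infinitesimal_extension_def)
  have p_shom: "p \<in> shom S (big N) (big G)" using p by (simp add: pair_map_def)
  interpret p: ring_hom_cring "big N" "big G" p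
    by unfold_locales (rule shomD[OF p_shom])
  have jc: "j b \<in> carrier (big N)" "ext N (j b) = ext D b" "p (j b) = l' b"
    if "b \<in> carrier (big D)" for b
  proof -
    show "j b \<in> carrier (big N)" using j that by (auto simp: pair_map_def dest: shomD)
    have "ext D b \<in> carrier (mid D)" using qDs that by auto
    then show "ext N (j b) = ext D b" using pair_mapD(1)[OF j that] by simp
    show "p (j b) = l' b" using that by (simp add: pj[symmetric] compose_def)
  qed
  have loc: "l' ` U \<subseteq> Units (big G)"
    "\<And>a. a \<in> carrier (big G) \<Longrightarrow> \<exists>r\<in>carrier (big D). \<exists>t\<in>U. a \<otimes>\<^bsub>big G\<^esub> l' t = l' r"
    using gen unfolding generic_pair_def is_localization_def U_def by auto
  have loc_mid: "is_localization (mid D) {b \<in> carrier (mid D). ext0 D b \<noteq> \<zero>\<^bsub>red D\<^esub>} (mid G) l"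
    and loc_red: "is_localization (red D) (carrier (red D) - {\<zero>\<^bsub>red D\<^esub>}) (red G) l0"
    using gen unfolding generic_pair_def by auto
  have sq0: "x \<otimes>\<^bsub>big N\<^esub> x = \<zero>\<^bsub>big N\<^esub>" if "x \<in> carrier (big N)" "ext N x = \<zero>\<^bsub>mid D\<^esub>" for x
  proof -
    have "x \<in> a_kernel (big N) (mid N) (ext N)"
      unfolding a_kernel_def' using that eq(1) by simp
    moreover have "x \<in> a_kernel (big N) (red N) (ext0 N \<circ> ext N)"
      unfolding a_kernel_def' eq using that q0.hom_zero by simp
    ultimately show ?thesis using N by (simp add: extension_pair_def)
  qed
  have "p ` T \<subseteq> Units (big G)"
  proof
    fix a assume "a \<in> p ` T"
    then obtain t where t: "t \<in> carrier (big N)" "ext0 D (ext N t) \<noteq> \<zero>\<^bsub>red D\<^esub>" "a = p t"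
      by (auto simp: T_def eq)
    \<comment> \<open>\<open>t\<close> differs from an element of the image of \<open>big D\<close> by an element of square zero.\<close>
    obtain b where b: "b \<in> carrier (big D)" "ext D b = ext N t"
      using qDs q.hom_closed[OF t(1)] by (metis imageE)
    define x where "x = t \<ominus>\<^bsub>big N\<^esub> j b"
    have x: "x \<in> carrier (big N)" using t(1) jc(1)[OF b(1)] by (simp add: x_def)
    have "ext N x = \<zero>\<^bsub>mid D\<^esub>"
      using t(1) jc(1,2)[OF b(1)] b(2) by (simp add: x_def a_minus_def B.r_neg)
    then have x2: "p x \<otimes>\<^bsub>big G\<^esub> p x = \<zero>\<^bsub>big G\<^esub>"
      using sq0[OF x] p.hom_mult[OF x x] by simp
    have "t = j b \<oplus>\<^bsub>big N\<^esub> x"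
      unfolding x_def using t(1) jc(1)[OF b(1)] by algebra
    then have "a = l' b \<oplus>\<^bsub>big G\<^esub> p x"
      using t(3) x jc(1,3)[OF b(1)] by simp
    moreover have "l' b \<in> Units (big G)"
      using loc(1) b t(2) by (auto simp: U_def)
    ultimately show "a \<in> Units (big G)"
      using BG.unit_plus_square_zero[OF _ _ x2] x by simp
  qed
  moreover have "\<exists>r\<in>carrier (big N). \<exists>t\<in>T. a \<otimes>\<^bsub>big G\<^esub> p t = p r" if a: "a \<in> carrier (big G)" for a
  proof -
    obtain r t where rt: "r \<in> carrier (big D)" "t \<in> U" "a \<otimes>\<^bsub>big G\<^esub> l' t = l' r"
      using loc(2)[OF a] by blast
    then have "t \<in> carrier (big D)" "j t \<in> T"
      using jc by (auto simp: U_def T_def eq)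
    then show ?thesis using rt jc by metis
  qed
  moreover have "\<exists>t\<in>T. t \<otimes>\<^bsub>big N\<^esub> r = t \<otimes>\<^bsub>big N\<^esub> r'"
    if r: "r \<in> carrier (big N)" and r': "r' \<in> carrier (big N)" and pr: "p r = p r'" for r r'
  proof -
    have "l (ext N r) = l (ext N r')"
      using pair_mapD(1)[OF p r] pair_mapD(1)[OF p r'] pr by simp
    then obtain s where s: "s \<in> carrier (mid D)" "ext0 D s \<noteq> \<zero>\<^bsub>red D\<^esub>"
      "s \<otimes>\<^bsub>mid D\<^esub> ext N r = s \<otimes>\<^bsub>mid D\<^esub> ext N r'"
      using loc_mid q.hom_closed[OF r] q.hom_closed[OF r'] unfolding is_localization_def by blast
    then obtain t where t: "t \<in> carrier (big N)" "ext N t = s"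
      using qs by (metis imageE)
    have "t \<otimes>\<^bsub>big N\<^esub> r = t \<otimes>\<^bsub>big N\<^esub> r'"
      by (rule inj_onD[OF inj]) (use t r r' pr s in auto)
    then show ?thesis using t s by (auto simp: T_def eq)
  qed
  ultimately have "is_localization (big N) T (big G) p"
    using p_shom by (auto simp: is_localization_def shom_def)
  then show ?thesis
    using p loc_mid loc_red eq unfolding generic_pair_def T_def by simp
qed


section \<open>Arrows of a fibred category\<close>

lemma idhom_shom:
  assumes "category_over S X" "x \<in> Ob X"
  shows "idhom (base X x) \<in> shom S (base X x) (base X x)"
proof -
  interpret category_over S X by fact
  show ?thesis using idn_arr[OF assms(2)] bmap_shom[of "idn X x"] by (simp add: arr_def)
qed

context category_over
begin

lemma arrD:
  assumes "arr X m x y h"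
  shows "m \<in> Ar X" "src X m = x" "trg X m = y" "bmap X m = h" "x \<in> Ob X" "y \<in> Ob X"
    "h \<in> shom S (base X y) (base X x)"
  using assms src_Ob trg_Ob bmap_shom unfolding arr_def by auto

lemma cmp_simps:
  assumes "m \<in> Ar X" "n \<in> Ar X" "trg X m = src X n"
  shows "cmp X n m \<in> Ar X" "src X (cmp X n m) = src X m" "trg X (cmp X n m) = trg X n"
  using cmp_arr[OF assms] by (auto simp: arr_def)

lemma idn_simps:
  assumes "x \<in> Ob X"
  shows "idn X x \<in> Ar X" "src X (idn X x) = x" "trg X (idn X x) = x"
  using idn_arr[OF assms] by (auto simp: arr_def)

lemma arr_cmp:
  assumes "arr X m x y h" "arr X n y z k"
  shows "arr X (cmp X n m) x z (compose (carrier (base X z)) h k)"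
  using cmp_arr[of m n] arrD[OF assms(1)] arrD[OF assms(2)] by auto

lemma arr_cmp_fibre:
  assumes "arr X m x y h" "arr X n y z (idhom (base X z))" "base X y = base X z"
  shows "arr X (cmp X n m) x z h"
  using arr_cmp[OF assms(1,2)] arrD(7)[OF assms(1)] assms(3)
  by (simp add: compose_idhom_right shomD(2))

lemma fibre_cmp_arr:
  assumes "arr X m x y (idhom (base X y))" "arr X n y z k" "base X x = base X y"
  shows "arr X (cmp X n m) x z k"
  using arr_cmp[OF assms(1,2)] arrD(7)[OF assms(2)] assms(3) by (simp add: compose_idhom_left)

lemma assoc:
  "\<lbrakk>l \<in> Ar X; m \<in> Ar X; n \<in> Ar X; trg X l = src X m; trg X m = src X n\<rbrakk> \<Longrightarrow>
      cmp X (cmp X n m) l = cmp X n (cmp X m l)"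
  by (rule cmp_assoc[symmetric])

lemma fibre_isoE:
  assumes "fibre_iso X m x y"
  obtains n where "fibre_iso X n y x" "arr X n y x (idhom (base X y))" "cmp X n m = idn X x" "cmp X m n = idn X y"
  using assms unfolding fibre_iso_def by metis

lemma fibre_isoD:
  assumes "fibre_iso X m x y"
  shows "arr X m x y (idhom (base X x))" "base X x = base X y"
  using assms unfolding fibre_iso_def by auto

lemma fibre_iso_idn:
  assumes "x \<in> Ob X"
  shows "fibre_iso X (idn X x) x x"
  using idn_arr[OF assms] idn_cmp[of "idn X x"] unfolding fibre_iso_def by (auto simp: arr_def)

lemma fibre_iso_cmp:
  assumes m: "fibre_iso X m x y" and n: "fibre_iso X n y z"
  shows "fibre_iso X (cmp X n m) x z"
proof -
  obtain m' where m': "fibre_iso X m' y x" "cmp X m' m = idn X x" "cmp X m m' = idn X y"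
    using m by (rule fibre_isoE)
  obtain n' where n': "fibre_iso X n' z y" "cmp X n' n = idn X y" "cmp X n n' = idn X z"
    using n by (rule fibre_isoE)
  note a = fibre_isoD[OF m] fibre_isoD[OF n] fibre_isoD[OF m'(1)] fibre_isoD[OF n'(1)]
  note s = arrD[OF a(1)] arrD[OF a(3)] arrD[OF a(5)] arrD[OF a(7)]
  have "cmp X (cmp X m' n') (cmp X n m) = cmp X m' (cmp X (cmp X n' n) m)"
    using s by (simp add: assoc cmp_simps)
  also have "\<dots> = idn X x"
    using s m'(2) n'(2) idn_cmp[of m] by simp
  finally have 1: "cmp X (cmp X m' n') (cmp X n m) = idn X x" .
  have "cmp X (cmp X n m) (cmp X m' n') = cmp X n (cmp X (cmp X m m') n')"
    using s by (simp add: assoc cmp_simps)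
  also have "\<dots> = idn X z"
    using s m'(3) n'(3) idn_cmp[of n'] by simp
  finally have 2: "cmp X (cmp X n m) (cmp X m' n') = idn X z" .
  have "arr X (cmp X n m) x z (idhom (base X x))"
    using arr_cmp_fibre[OF a(1) _ a(4)] a(3,4) by simp
  moreover have "arr X (cmp X m' n') z x (idhom (base X z))"
    using arr_cmp_fibre[OF a(7) _ a(6)] a(5,6) by simp
  ultimately show ?thesis
    unfolding fibre_iso_def using 1 2 a(2,4) by auto
qed

end

text \<open>Every arrow is cartesian, and a cartesian arrow over an identity is invertible: lift the identity
  of its target along it.\<close>

lemma (in fibred_in_groupoids) fibre_arrow_iso:
  assumes m: "arr X m x y (idhom (base X y))" and b: "base X x = base X y"
  shows "fibre_iso X m x y"
proof -
  note s = arrD[OF m]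
  have id: "idhom (base X y) \<in> shom S (base X y) (base X y)"
    using idhom_shom[OF category_over_axioms s(6)] .
  note ss = idn_simps[OF s(5)] idn_simps[OF s(6)]
  have bi: "bmap X (idn X y) = idhom (base X y)" "bmap X (idn X x) = idhom (base X x)"
    using idn_arr s by (auto simp: arr_def)
  obtain n where n: "arr X n y x (idhom (base X y))" "cmp X m n = idn X y"
    using cartesian[of m "idn X y" "idhom (base X y)"] s ss bi b id
    by (auto simp: compose_idhom_left)
  note sn = arrD[OF n(1)]
  \<comment> \<open>Both \<open>n m\<close> and the identity lift \<open>m\<close> along \<open>m\<close>, so the uniqueness half identifies them.\<close>
  have "\<exists>!l. arr X l (src X m) (src X m) (idhom (base X y)) \<and> cmp X m l = m"
    using cartesian[of m m "idhom (base X y)"] s b id by (auto simp: compose_idhom_left)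
  moreover have "arr X (cmp X n m) x x (idhom (base X y))"
    using arr_cmp_fibre[OF m _ b[symmetric]] n(1) b by simp
  moreover have "cmp X m (cmp X n m) = m"
    using s sn n(2) idn_cmp[of m] by (simp add: assoc[symmetric])
  moreover have "arr X (idn X x) x x (idhom (base X y))"
    using idn_arr[OF s(5)] b by simp
  moreover have "cmp X m (idn X x) = m"
    using cmp_idn[of m] s by simp
  ultimately have "cmp X n m = idn X x"
    using s(2) by metis
  then show ?thesis
    unfolding fibre_iso_def using m n b by auto
qed

lemma one_morphismD:
  assumes "one_morphism X Y f"
  shows "x \<in> Ob X \<Longrightarrow> obj f x \<in> Ob Y" "x \<in> Ob X \<Longrightarrow> base Y (obj f x) = base X x"
    "x \<in> Ob X \<Longrightarrow> mor f (idn X x) = idn Y (obj f x)"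
    "arr X m x y h \<Longrightarrow> arr Y (mor f m) (obj f x) (obj f y) h"
    "\<lbrakk>m \<in> Ar X; n \<in> Ar X; trg X m = src X n\<rbrakk> \<Longrightarrow> mor f (cmp X n m) = cmp Y (mor f n) (mor f m)"
  using assms unfolding one_morphism_def by (auto simp: arr_def)

lemma one_morphism_simps:
  assumes "one_morphism X Y f" "m \<in> Ar X"
  shows "mor f m \<in> Ar Y" "src Y (mor f m) = obj f (src X m)" "trg Y (mor f m) = obj f (trg X m)"
  using assms unfolding one_morphism_def arr_def by auto

lemma one_morphism_fibre_iso:
  assumes "category_over S X" "one_morphism X Y f" "fibre_iso X m x y"
  shows "fibre_iso Y (mor f m) (obj f x) (obj f y)"
proof -
  interpret category_over S X by fact
  note f = one_morphismD[OF assms(2)]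
  obtain n where n: "arr X n y x (idhom (base X y))" "cmp X n m = idn X x" "cmp X m n = idn X y"
    using assms(3) by (rule fibre_isoE)
  note m = fibre_isoD[OF assms(3)]
  note s = arrD[OF n(1)] arrD[OF m(1)]
  have "cmp Y (mor f n) (mor f m) = idn Y (obj f x)" "cmp Y (mor f m) (mor f n) = idn Y (obj f y)"
    using f(5)[of m n] f(5)[of n m] n f(3) s by auto
  then show ?thesis
    unfolding fibre_iso_def using f(2)[of x] f(2)[of y] f(4)[OF m(1)] f(4)[OF n(1)] s m(2) by auto
qed

lemma one_morphism_comp:
  assumes "one_morphism W X e" "one_morphism X Y f"
  shows "one_morphism W Y (morph_comp f e)"
  using assms unfolding one_morphism_def morph_comp_def arr_def by simp


section \<open>Composition of base changes\<close>

lemma base_changeD: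
  assumes "is_base_change S X Y f D1 D2 h' h h0 v w"
  shows "deformation_situation S X Y f D1" "deformation_situation S X Y f D2"
    "pair_map S D1 D2 h' h h0" "arr Y v (yobj D2) (yobj D1) h'" "arr X w (xobj D2) (xobj D1) h"
    "cmp Y v (cmp Y (yarr D2) (siso D2)) = cmp Y (yarr D1) (cmp Y (siso D1) (mor f w))"
  using assms by (simp_all add: is_base_change_def)

lemma situationD:
  assumes "deformation_situation S X Y f D"
  shows "extension_pair S D" "yobj D \<in> Ob Y" "base Y (yobj D) = big D"
    "xobj D \<in> Ob X" "base X (xobj D) = mid D" "yres D \<in> Ob Y" "base Y (yres D) = mid D"
    "arr Y (yarr D) (yres D) (yobj D) (ext D)" "fibre_iso Y (siso D) (obj f (xobj D)) (yres D)"
    "arr Y (siso D) (obj f (xobj D)) (yres D) (idhom (base Y (obj f (xobj D))))"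
  using assms unfolding deformation_situation_def fibre_iso_def by blast+

lemma liftD:
  assumes "is_lift X Y f D L"
  shows "lobj L \<in> Ob X" "base X (lobj L) = big D" "lres L \<in> Ob X" "base X (lres L) = mid D"
    "arr X (larr L) (lres L) (lobj L) (ext D)" "fibre_iso X (lxiso L) (lres L) (xobj D)"
    "fibre_iso Y (lyiso L) (obj f (lobj L)) (yobj D)"
    "cmp Y (yarr D) (cmp Y (siso D) (mor f (lxiso L))) = cmp Y (lyiso L) (mor f (larr L))"
    "arr X (lxiso L) (lres L) (xobj D) (idhom (base X (lres L)))"
    "arr Y (lyiso L) (obj f (lobj L)) (yobj D) (idhom (base Y (obj f (lobj L))))"
  using assms unfolding is_lift_def fibre_iso_def by blast+

lemma base_change_trans:
  assumes S: "presheaf S" and X: "category_over S X" and Y: "category_over S Y"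
    and f: "one_morphism X Y f"
    and D12: "is_base_change S X Y f D1 D2 h' h h0 v w"
    and D23: "is_base_change S X Y f D2 D3 k' k k0 v' w'"
  shows "is_base_change S X Y f D1 D3 (compose (carrier (big D1)) k' h')
    (compose (carrier (mid D1)) k h) (compose (carrier (red D1)) k0 h0) (cmp Y v v') (cmp X w w')"
proof -
  interpret X: category_over S X by fact
  interpret Y: category_over S Y by fact
  note b1 = base_changeD[OF D12] and b2 = base_changeD[OF D23]
  note d1 = situationD[OF b1(1)] and d2 = situationD[OF b1(2)] and d3 = situationD[OF b2(2)]
  note a = Y.arrD(1-6)[OF b1(4)] Y.arrD(1-6)[OF b2(4)] X.arrD(1-6)[OF b1(5)] X.arrD(1-6)[OF b2(5)]
    Y.arrD(1-6)[OF d1(8)] Y.arrD(1-6)[OF d2(8)] Y.arrD(1-6)[OF d3(8)]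
    Y.arrD(1-3)[OF d1(10)] Y.arrD(1-3)[OF d2(10)] Y.arrD(1-3)[OF d3(10)]
  note s = X.assoc Y.assoc X.cmp_simps Y.cmp_simps one_morphismD(5)[OF f] one_morphism_simps[OF f]
  have "cmp Y (cmp Y v v') (cmp Y (yarr D3) (siso D3)) = cmp Y v (cmp Y v' (cmp Y (yarr D3) (siso D3)))"
    using a by (simp add: s)
  also have "\<dots> = cmp Y (cmp Y v (cmp Y (yarr D2) (siso D2))) (mor f w')"
    unfolding b2(6) using a by (simp add: s)
  also have "\<dots> = cmp Y (yarr D1) (cmp Y (siso D1) (mor f (cmp X w w')))"
    unfolding b1(6) using a by (simp add: s)
  finally have eq: "cmp Y (cmp Y v v') (cmp Y (yarr D3) (siso D3))
      = cmp Y (yarr D1) (cmp Y (siso D1) (mor f (cmp X w w')))" .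
  have "arr Y (cmp Y v v') (yobj D3) (yobj D1) (compose (carrier (big D1)) k' h')"
    using Y.arr_cmp[OF b2(4) b1(4)] d1(3) by simp
  moreover have "arr X (cmp X w w') (xobj D3) (xobj D1) (compose (carrier (mid D1)) k h)"
    using X.arr_cmp[OF b2(5) b1(5)] d1(5) by simp
  ultimately show ?thesis
    unfolding is_base_change_def using eq b1(1) b2(2) pair_map_trans[OF S d1(1) d2(1) d3(1) b1(3) b2(3)]
    by blast
qed


section \<open>Situations and lifts along a composite\<close>

text \<open>A situation over \<open>f \<circ> e\<close> seen as one over \<open>f\<close>: only the source object has to be moved, since
  \<open>siso\<close> already starts at \<open>f(e(x))\<close>.\<close>

definition source_image ::
    "('w, 'wm, 'x, 'xm) morph \<Rightarrow> ('a, 's, 'w, 'y, 'ym) situation \<Rightarrow> ('a, 's, 'x, 'y, 'ym) situation"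
  where
  "source_image e D = \<lparr>big = big D, mid = mid D, red = red D, ext = ext D, ext0 = ext0 D,
     yobj = yobj D, xobj = obj e (xobj D), yres = yres D, yarr = yarr D, siso = siso D\<rparr>"

definition source_image_lift ::
    "('w, 'wm, 'x, 'xm) morph \<Rightarrow> ('w, 'wm, 'ym) lift \<Rightarrow> ('x, 'xm, 'ym) lift" where
  "source_image_lift e L = \<lparr>lobj = obj e (lobj L), lres = obj e (lres L), larr = mor e (larr L),
     lxiso = mor e (lxiso L), lyiso = lyiso L\<rparr>"

definition target_image ::
    "('x, 'xm, 'y, 'ym) morph \<Rightarrow> ('a, 's, 'w, 'x, 'xm) situation \<Rightarrow> ('a, 's, 'w, 'y, 'ym) situation"
  where
  "target_image f D = \<lparr>big = big D, mid = mid D, red = red D, ext = ext D, ext0 = ext0 D,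
     yobj = obj f (yobj D), xobj = xobj D, yres = obj f (yres D), yarr = mor f (yarr D),
     siso = mor f (siso D)\<rparr>"

definition target_image_lift ::
    "('x, 'xm, 'y, 'ym) morph \<Rightarrow> ('w, 'wm, 'xm) lift \<Rightarrow> ('w, 'wm, 'ym) lift" where
  "target_image_lift f L = \<lparr>lobj = lobj L, lres = lres L, larr = larr L,
     lxiso = lxiso L, lyiso = mor f (lyiso L)\<rparr>"

text \<open>
  The problem of lifting the object \<open>b'\<^sub>X\<close> of a lift \<open>L\<close> along a second morphism \<open>e\<close>: the
  restriction \<open>b'\<^sub>X|\<^sub>B\<close> comes with \<open>L\<close>, and \<open>s : e(x) \<rightarrow> b'\<^sub>X|\<^sub>B\<close> says that \<open>x\<close> is a lift of it.
\<close>

definition lift_situation ::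
    "('a, 's, 'z) extpair_scheme \<Rightarrow> ('x, 'xm, 'ym) lift \<Rightarrow> 'w \<Rightarrow> 'xm \<Rightarrow> ('a, 's, 'w, 'x, 'xm) situation"
  where
  "lift_situation P L x s = \<lparr>big = big P, mid = mid P, red = red P, ext = ext P, ext0 = ext0 P,
     yobj = lobj L, xobj = x, yres = lres L, yarr = larr L, siso = s\<rparr>"

lemma image_simps [simp]:
  "big (source_image e D) = big D" "mid (source_image e D) = mid D" "red (source_image e D) = red D"
  "ext (source_image e D) = ext D" "ext0 (source_image e D) = ext0 D"
  "yobj (source_image e D) = yobj D" "xobj (source_image e D) = obj e (xobj D)"
  "yres (source_image e D) = yres D" "yarr (source_image e D) = yarr D" "siso (source_image e D) = siso D"
  "lobj (source_image_lift e L) = obj e (lobj L)" "lres (source_image_lift e L) = obj e (lres L)"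
  "larr (source_image_lift e L) = mor e (larr L)" "lxiso (source_image_lift e L) = mor e (lxiso L)"
  "lyiso (source_image_lift e L) = lyiso L"
  "big (target_image f E) = big E" "mid (target_image f E) = mid E" "red (target_image f E) = red E"
  "ext (target_image f E) = ext E" "ext0 (target_image f E) = ext0 E"
  "yobj (target_image f E) = obj f (yobj E)" "xobj (target_image f E) = xobj E"
  "yres (target_image f E) = obj f (yres E)" "yarr (target_image f E) = mor f (yarr E)"
  "siso (target_image f E) = mor f (siso E)"
  "lobj (target_image_lift f M) = lobj M" "lres (target_image_lift f M) = lres M"
  "larr (target_image_lift f M) = larr M" "lxiso (target_image_lift f M) = lxiso M"
  "lyiso (target_image_lift f M) = mor f (lyiso M)"
  "big (lift_situation P K x s) = big P" "mid (lift_situation P K x s) = mid P"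
  "red (lift_situation P K x s) = red P" "ext (lift_situation P K x s) = ext P"
  "ext0 (lift_situation P K x s) = ext0 P" "yobj (lift_situation P K x s) = lobj K"
  "xobj (lift_situation P K x s) = x" "yres (lift_situation P K x s) = lres K"
  "yarr (lift_situation P K x s) = larr K" "siso (lift_situation P K x s) = s"
  "obj (morph_comp g h) c = obj g (obj h c)" "mor (morph_comp g h) m = mor g (mor h m)"
  by (simp_all add: source_image_def source_image_lift_def target_image_def target_image_lift_def
      lift_situation_def morph_comp_def)

lemma image_pair_simps [simp]:
  "extension_pair S (source_image e D) = extension_pair S D"
  "extension_pair S (target_image f E) = extension_pair S E"
  "extension_pair S (lift_situation P K x s) = extension_pair S P"
  by (simp_all add: extension_pair_def)

lemma image_pair_map_simps [simp]:
  "pair_map S (source_image e D) (source_image e D') = pair_map S D D'"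
  "pair_map S (target_image f E) (target_image f E') = pair_map S E E'"
  "pair_map S (lift_situation P K x s) (lift_situation P' K' x' s') = pair_map S P P'"
  by (simp_all add: pair_map_def fun_eq_iff)

lemma source_image_situation:
  assumes e: "one_morphism W X e" and D: "deformation_situation S W Y (morph_comp f e) D"
  shows "deformation_situation S X Y f (source_image e D)"
  using D one_morphismD(1,2)[OF e] unfolding deformation_situation_def by simp

lemma source_image_lift:
  assumes W: "category_over S W" and e: "one_morphism W X e" and L: "is_lift W Y (morph_comp f e) D L"
  shows "is_lift X Y f (source_image e D) (source_image_lift e L)"
  using L one_morphismD(1,2,4)[OF e] one_morphism_fibre_iso[OF W e] unfolding is_lift_def by simp

lemma source_image_base_change:
  assumes e: "one_morphism W X e"
    and D: "is_base_change S W Y (morph_comp f e) D1 D2 h' h h0 v w"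
  shows "is_base_change S X Y f (source_image e D1) (source_image e D2) h' h h0 v (mor e w)"
  using base_changeD[OF D] source_image_situation[OF e base_changeD(1)[OF D]]
    source_image_situation[OF e base_changeD(2)[OF D]] one_morphismD(4)[OF e]
  unfolding is_base_change_def by simp

context
  fixes S :: "('a, 's) psh" and W :: "('a, 's, 'w, 'wm) cat" and X :: "('a, 's, 'x, 'xm) cat"
    and Y :: "('a, 's, 'y, 'ym) cat" and e :: "('w, 'wm, 'x, 'xm) morph"
    and f :: "('x, 'xm, 'y, 'ym) morph"
  assumes W: "category_over S W" and X: "category_over S X" and Y: "category_over S Y"
    and e: "one_morphism W X e" and f: "one_morphism X Y f"
begin

interpretation W: category_over S W by (rule W)
interpretation X: category_over S X by (rule X)
interpretation Y: category_over S Y by (rule Y)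

lemmas cat_simps = W.assoc X.assoc Y.assoc W.cmp_simps X.cmp_simps Y.cmp_simps
  one_morphismD(5)[OF e] one_morphism_simps[OF e] one_morphismD(5)[OF f] one_morphism_simps[OF f]

lemma target_image_situation:
  assumes D: "deformation_situation S W X e D"
  shows "deformation_situation S W Y (morph_comp f e) (target_image f D)"
  using situationD[OF D] one_morphismD(1,2,4)[OF f] one_morphism_fibre_iso[OF X f, of "siso D"]
  unfolding deformation_situation_def by simp

lemma target_image_lift:
  assumes D: "deformation_situation S W X e D" and L: "is_lift W X e D L"
  shows "is_lift W Y (morph_comp f e) (target_image f D) (target_image_lift f L)"
proof -
  note d = situationD[OF D] and l = liftD[OF L]
  note a = X.arrD(1-6)[OF d(8)] X.arrD(1-3)[OF d(10)] W.arrD(1-6)[OF l(5)] W.arrD(1-3)[OF l(9)]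
    X.arrD(1-3)[OF l(10)]
  have "cmp Y (mor f (yarr D)) (cmp Y (mor f (siso D)) (mor f (mor e (lxiso L))))
      = mor f (cmp X (yarr D) (cmp X (siso D) (mor e (lxiso L))))"
    using a by (simp add: cat_simps)
  also have "\<dots> = cmp Y (mor f (lyiso L)) (mor f (mor e (larr L)))"
    unfolding l(8) using a by (simp add: cat_simps)
  finally show ?thesis
    using l(1-7) one_morphism_fibre_iso[OF X f, of "lyiso L"] unfolding is_lift_def by simp
qed

lemma target_image_base_change:
  assumes D: "is_base_change S W X e D1 D2 h' h h0 v w"
  shows "is_base_change S W Y (morph_comp f e) (target_image f D1) (target_image f D2) h' h h0 (mor f v) w"
proof -
  note b = base_changeD[OF D]
  note d1 = situationD[OF b(1)] and d2 = situationD[OF b(2)]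
  note a = X.arrD(1-6)[OF b(4)] W.arrD(1-6)[OF b(5)] X.arrD(1-6)[OF d1(8)] X.arrD(1-3)[OF d1(10)]
    X.arrD(1-6)[OF d2(8)] X.arrD(1-3)[OF d2(10)]
  have "cmp Y (mor f v) (cmp Y (mor f (yarr D2)) (mor f (siso D2))) = mor f (cmp X v (cmp X (yarr D2) (siso D2)))"
    using a by (simp add: cat_simps)
  also have "\<dots> = cmp Y (mor f (yarr D1)) (cmp Y (mor f (siso D1)) (mor f (mor e w)))"
    unfolding b(6) using a by (simp add: cat_simps)
  finally show ?thesis
    using b target_image_situation one_morphismD(4)[OF f b(4)] unfolding is_base_change_def by simp
qed

lemma lift_situation_is_situation:
  assumes P: "extension_pair S D" and L: "is_lift X Y f D L"
    and x: "x \<in> Ob W" "base W x = mid D" and s: "fibre_iso X s (obj e x) (lres L)"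
  shows "deformation_situation S W X e (lift_situation D L x s)"
  using P liftD[OF L] x s unfolding deformation_situation_def by simp

text \<open>A base change of lifts turns into a base change of the target data. The arrow \<open>r\<close> between the
  restrictions is the one that is required to exist in a base change of lifts; it mediates between
  the arrows to the target objects and the isomorphisms \<open>s1\<close>, \<open>s2\<close>.\<close>

lemma lift_situation_base_change:
  assumes P: "pair_map S D1 D2 h' h h0"
    and D1: "deformation_situation S W X e (lift_situation D1 L1 x1 s1)"
    and D2: "deformation_situation S W X e (lift_situation D2 L2 x2 s2)"
    and g: "arr X g (lobj L2) (lobj L1) h'" and u: "arr W u x2 x1 h" and r: "arr X r (lres L2) (lres L1) h"
    and gr: "cmp X (larr L1) r = cmp X g (larr L2)" and rs: "cmp X r s2 = cmp X s1 (mor e u)"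
  shows "is_base_change S W X e (lift_situation D1 L1 x1 s1) (lift_situation D2 L2 x2 s2) h' h h0 g u"
proof -
  note d1 = situationD[OF D1, simplified] and d2 = situationD[OF D2, simplified]
  note a = X.arrD(1-6)[OF g] W.arrD(1-6)[OF u] X.arrD(1-6)[OF r] X.arrD(1-6)[OF d1(8)] X.arrD(1-3)[OF d1(10)]
    X.arrD(1-6)[OF d2(8)] X.arrD(1-3)[OF d2(10)]
  have "cmp X g (cmp X (larr L2) s2) = cmp X (cmp X (larr L1) r) s2"
    unfolding gr using a by (simp add: cat_simps)
  also have "\<dots> = cmp X (larr L1) (cmp X s1 (mor e u))"
    using a rs by (simp add: cat_simps)
  finally show ?thesis
    using P D1 D2 g u unfolding is_base_change_def by simp
qed

text \<open>
  If \<open>L\<close> is a lift over \<open>N\<close>, the object \<open>f(b'\<^sub>X)\<close> is isomorphic to the target object of \<open>N\<close>, so it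
  may replace the latter as a restriction of the target object of \<open>D\<close>. The hypothesis on \<open>s\<close> says that
  passing from \<open>e(x)\<close> through \<open>L\<close> and \<open>N\<close> back to \<open>e(x)\<close> is the identity, so that the
  isomorphism of the new situation is the one induced by that of \<open>D\<close>.
\<close>

lemma base_change_to_lift_situation:
  assumes D: "deformation_situation S W Y (morph_comp f e) D"
    and N: "is_base_change S X Y f (source_image e D) N j (idhom (mid D)) (idhom (red D)) v w"
    and L: "is_lift X Y f N L" and mid: "mid N = mid D"
    and T: "deformation_situation S W X e (lift_situation N L (xobj D) s)"
    and s: "cmp X w (cmp X (lxiso L) s) = idn X (obj e (xobj D))"
  shows "is_base_change S W Y (morph_comp f e) D (target_image f (lift_situation N L (xobj D) s))
    j (idhom (mid D)) (idhom (red D)) (cmp Y v (lyiso L)) (idn W (xobj D))"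
proof -
  let ?id = "idn W (xobj D)"
  note b = base_changeD[OF N, simplified] and l = liftD[OF L]
  note d = situationD[OF D, simplified] and n = situationD[OF b(2)] and t = situationD[OF T, simplified]
  note i = W.idn_simps[OF d(4)] one_morphismD(3)[OF e d(4)]
  note a = Y.arrD(1-6)[OF b(4)] X.arrD(1-6)[OF b(5)] Y.arrD(1-6)[OF d(8)] Y.arrD(1-3)[OF d(10)]
    Y.arrD(1-6)[OF n(8)] Y.arrD(1-3)[OF n(10)] X.arrD(1-6)[OF l(5)] X.arrD(1-6)[OF l(9)] Y.arrD(1-3)[OF l(10)]
    X.arrD(1-3)[OF t(10)]
  have "cmp Y (cmp Y v (lyiso L)) (cmp Y (mor f (larr L)) (mor f s))
      = cmp Y v (cmp Y (cmp Y (lyiso L) (mor f (larr L))) (mor f s))"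
    using a by (simp add: cat_simps)
  also have "\<dots> = cmp Y (cmp Y v (cmp Y (yarr N) (siso N))) (mor f (cmp X (lxiso L) s))"
    unfolding l(8)[symmetric] using a by (simp add: cat_simps)
  also have "\<dots> = cmp Y (yarr D) (cmp Y (siso D) (mor f (cmp X w (cmp X (lxiso L) s))))"
    unfolding b(6) using a by (simp add: cat_simps)
  also have "\<dots> = cmp Y (yarr D) (cmp Y (siso D) (mor f (mor e ?id)))"
    unfolding s i(4) ..
  finally have eq: "cmp Y (cmp Y v (lyiso L)) (cmp Y (mor f (larr L)) (mor f s))
      = cmp Y (yarr D) (cmp Y (siso D) (mor f (mor e ?id)))" .
  have "pair_map S D (lift_situation N L (xobj D) s) j (idhom (mid D)) (idhom (red D))"
    using b(3) by (simp add: pair_map_def)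
  moreover have "arr Y (cmp Y v (lyiso L)) (obj f (lobj L)) (yobj D) j"
    using Y.fibre_cmp_arr[OF _ b(4)] l(10) one_morphismD(2)[OF f l(1)] l(2) n(3) by simp
  moreover have "arr W ?id (xobj D) (xobj D) (idhom (mid D))"
    using W.idn_arr[OF d(4)] d(5) by simp
  ultimately show ?thesis
    using D target_image_situation[OF T] eq unfolding is_base_change_def
    by (simp add: pair_map_def)
qed

text \<open>Over the same extension pair, the isomorphism \<open>f(e(b'\<^sub>W)) \<rightarrow> b'\<^sub>Y\<close> of a lift \<open>L\<close> identifies \<open>G\<close> with
  the image of the situation made from \<open>e(L)\<close>; a vertical isomorphism counts as a base change along
  identities.\<close>

lemma base_change_from_lift_situation:
  assumes S: "presheaf S" and G: "deformation_situation S W Y (morph_comp f e) G"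
    and L: "is_lift W Y (morph_comp f e) G L"
    and T: "deformation_situation S W X e (lift_situation G (source_image_lift e L) (xobj G) s)"
    and s: "cmp X (mor e (lxiso L)) s = idn X (obj e (xobj G))"
    and n: "arr Y n (yobj G) (obj f (obj e (lobj L))) (idhom (big G))"
      "cmp Y n (lyiso L) = idn Y (obj f (obj e (lobj L)))"
  shows "is_base_change S W Y (morph_comp f e)
    (target_image f (lift_situation G (source_image_lift e L) (xobj G) s)) G
    (idhom (big G)) (idhom (mid G)) (idhom (red G)) n (idn W (xobj G))"
proof -
  let ?id = "idn W (xobj G)"
  note l = liftD[OF L, simplified]
  note d = situationD[OF G, simplified] and t = situationD[OF T, simplified]
  note i = W.idn_simps[OF d(4)] one_morphismD(3)[OF e d(4)]
  note a = Y.arrD(1-6)[OF d(8)] Y.arrD(1-3)[OF d(10)] W.arrD(1-6)[OF l(5)] W.arrD(1-6)[OF l(9)] Y.arrD(1-3)[OF l(10)]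
    X.arrD(1-3)[OF t(10)] Y.arrD(1-3)[OF n(1)]
  have fs: "mor f s = cmp Y (mor f s) (mor f (mor e ?id))"
    using X.cmp_idn[of s] X.idn_simps[of "obj e (xobj G)"] a i one_morphismD(1)[OF e d(4)]
      one_morphismD(5)[OF f, of "mor e ?id" s] by simp
  have "cmp Y n (cmp Y (yarr G) (siso G))
      = cmp Y n (cmp Y (yarr G) (cmp Y (siso G) (mor f (cmp X (mor e (lxiso L)) s))))"
    unfolding s using one_morphismD(3)[OF f, of "obj e (xobj G)"] one_morphismD(1)[OF e d(4)]
      Y.cmp_idn[of "siso G"] a by simp
  also have "\<dots> = cmp Y n (cmp Y (cmp Y (yarr G) (cmp Y (siso G) (mor f (mor e (lxiso L))))) (mor f s))"
    using a by (simp add: cat_simps)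
  also have "\<dots> = cmp Y (cmp Y n (lyiso L)) (cmp Y (mor f (mor e (larr L))) (mor f s))"
    unfolding l(8) using a by (simp add: cat_simps)
  also have "\<dots> = cmp Y (mor f (mor e (larr L))) (mor f s)"
    unfolding n(2) using a Y.idn_cmp[of "cmp Y (mor f (mor e (larr L))) (mor f s)"] by (simp add: cat_simps)
  also have "\<dots> = cmp Y (mor f (mor e (larr L))) (cmp Y (mor f s) (mor f (mor e ?id)))"
    using fs by simp
  finally have eq: "cmp Y n (cmp Y (yarr G) (siso G))
      = cmp Y (mor f (mor e (larr L))) (cmp Y (mor f s) (mor f (mor e ?id)))" .
  have "pair_map S (target_image f (lift_situation G (source_image_lift e L) (xobj G) s)) G
     (idhom (big G)) (idhom (mid G)) (idhom (red G))"
    using pair_map_refl[OF S d(1), of G] by (simp add: pair_map_def)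
  moreover have "arr W ?id (xobj G) (xobj G) (idhom (mid G))"
    using W.idn_arr[OF d(4)] d(5) by simp
  ultimately show ?thesis
    using G target_image_situation[OF T] eq n(1) unfolding is_base_change_def by simp
qed

end

theorem proposition2p9:
  fixes S :: "('a, 's) psh"
    and W :: "('a, 's, 'w, 'wm) cat"
    and X :: "('a, 's, 'x, 'xm) cat"
    and Y :: "('a, 's, 'y, 'ym) cat"
    and e :: "('w, 'wm, 'x, 'xm) morph"
    and f :: "('x, 'xm, 'y, 'ym) morph"
  assumes "infinite (UNIV :: 'a set)"
    and "locally_noetherian_algebraic_space S"
    and "stack S W" and "stack S X" and "stack S Y"
    and "one_morphism W X e" and "one_morphism X Y f"
    and "generic_lifts_integral S W X e" and "generic_lifts_integral S X Y f"
  shows "generic_lifts_integral S W Y (morph_comp f e)"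
  unfolding generic_lifts_integral_def
proof (intro allI impI)
  fix D G :: "('a, 's, 'w, 'y, 'ym) situation" and l' l l0 v w and L :: "('w, 'wm, 'ym) lift"
  let ?fe = "morph_comp f e"
  assume D: "deformation_situation S W Y ?fe D \<and> integral_situation D \<and> algebraic_situation S D"
    and GL: "generic_lift S W Y ?fe D G l' l l0 v w L"
  interpret W: fibred_in_groupoids S W using assms(3) by (simp add: stack_def)
  interpret X: fibred_in_groupoids S X using assms(4) by (simp add: stack_def)
  interpret Y: fibred_in_groupoids S Y using assms(5) by (simp add: stack_def)
  note cats = W.category_over_axioms X.category_over_axioms Y.category_over_axioms
  note e = \<open>one_morphism W X e\<close> and f = \<open>one_morphism X Y f\<close>
  have S: "presheaf S"
    using assms(2) by (simp add: locally_noetherian_algebraic_space_def sheaf_def)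
  have gen: "generic_pair S D G l' l l0" and DG: "is_base_change S W Y ?fe D G l' l l0 v w"
    and L: "is_lift W Y ?fe G L"
    using GL by (simp_all add: generic_lift_def)
  have D': "deformation_situation S W Y ?fe D" and G: "deformation_situation S W Y ?fe G"
    using base_changeD[OF DG] by auto
  note d = situationD[OF D', simplified] and g = situationD[OF G, simplified] and lL = liftD[OF L, simplified]

  \<comment> \<open>First stage: extend \<open>e(L)\<close>.\<close>
  let ?D1 = "source_image e D" and ?G1 = "source_image e G" and ?L1 = "source_image_lift e L"
  have "generic_lift S X Y f ?D1 ?G1 l' l l0 v (mor e w) ?L1"
    using gen source_image_base_change[OF e DG] source_image_lift[OF cats(1) e L]
    by (simp add: generic_lift_def generic_pair_def pair_map_def)
  moreover have "integral_situation ?D1" "algebraic_situation S ?D1"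
    using D by (simp_all add: integral_situation_def algebraic_situation_def)
  ultimately obtain N1 LN1 where "integral_lift S X Y f ?D1 ?G1 l' l l0 v (mor e w) ?L1 N1 LN1"
    using assms(9) source_image_situation[OF e D'] unfolding generic_lifts_integral_def by blast
  then obtain j p v' w' v'' w'' k where
    N1: "mid N1 = mid D" "red N1 = red D" "ext0 N1 = ext0 D" "is_lift X Y f N1 LN1"
    and DN1: "is_base_change S X Y f ?D1 N1 j (idhom (mid D)) (idhom (red D)) v' w'"
    and inj: "inj_on (\<lambda>b. (p b, ext N1 b)) (carrier (big N1))"
    and pj: "compose (carrier (big D)) p j = l'"
    and N1G: "is_base_change S X Y f N1 ?G1 p l l0 v'' w''"
    and vw: "cmp Y v' v'' = v" "cmp X w' w'' = mor e w"
    and LL1: "is_lift_base_change X Y f LN1 ?L1 p l v'' w'' k"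
    unfolding integral_lift_def by auto
  then obtain r where k: "arr X k (obj e (lobj L)) (lobj LN1) p"
    and kv: "cmp Y v'' (lyiso L) = cmp Y (lyiso LN1) (mor f k)"
    and r: "arr X r (obj e (lres L)) (lres LN1) l" "cmp X (larr LN1) r = cmp X k (mor e (larr L))"
      "cmp X w'' (mor e (lxiso L)) = cmp X (lxiso LN1) r"
    unfolding is_lift_base_change_def by auto
  note b1 = base_changeD[OF DN1, simplified] and b2 = base_changeD[OF N1G, simplified]
  note n1 = situationD[OF b1(2)] and lN1 = liftD[OF N1(4)]

  \<comment> \<open>Second stage: \<open>LN1\<close> and \<open>e(L)\<close> become the targets. The isomorphisms \<open>s1\<close>, \<open>s2\<close> from \<open>e\<close> of the
    given objects to the restrictions of the targets are inverses of the ones that the lifts and the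
    base change \<open>DN1\<close> provide.\<close>
  have "fibre_iso X w' (xobj N1) (obj e (xobj D))"
    using X.fibre_arrow_iso[of w' "xobj N1" "obj e (xobj D)"] b1(5) n1(5) one_morphismD(2)[OF e d(4)]
      d(5) N1(1) by simp
  then obtain s1 where s1: "fibre_iso X s1 (obj e (xobj D)) (lres LN1)"
    "cmp X s1 (cmp X w' (lxiso LN1)) = idn X (lres LN1)"
    "cmp X (cmp X w' (lxiso LN1)) s1 = idn X (obj e (xobj D))"
    using X.fibre_isoE[OF X.fibre_iso_cmp[OF lN1(6)]] by metis
  obtain s2 where s2: "fibre_iso X s2 (obj e (xobj G)) (obj e (lres L))"
    "cmp X s2 (mor e (lxiso L)) = idn X (obj e (lres L))"
    "cmp X (mor e (lxiso L)) s2 = idn X (obj e (xobj G))"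
    using X.fibre_isoE[OF one_morphism_fibre_iso[OF cats(1) e lL(6)]] by metis
  let ?D2 = "lift_situation N1 LN1 (xobj D) s1" and ?G2 = "lift_situation G ?L1 (xobj G) s2"
  let ?L2 = "\<lparr>lobj = lobj L, lres = lres L, larr = larr L, lxiso = lxiso L, lyiso = idn X (obj e (lobj L))\<rparr>"
  have D2: "deformation_situation S W X e ?D2"
    by (rule lift_situation_is_situation[OF cats e f n1(1) N1(4) d(4) _ s1(1)]) (use d N1 in simp)
  have G2: "deformation_situation S W X e ?G2"
    using lift_situation_is_situation[OF cats e f _ source_image_lift[OF cats(1) e L], of "xobj G" s2] g s2(1)
    by (simp add: lift_situation_def)
  note aw = X.arrD(1-6)[OF b1(5)] X.arrD(1-6)[OF b2(5)] X.arrD(1-6)[OF r(1)] X.arrD(1-6)[OF k]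
    X.arrD(1-6)[OF lN1(9)] W.arrD(1-6)[OF lL(9)] X.arrD(1-6)[OF X.fibre_isoD(1)[OF s1(1)]]
    X.arrD(1-6)[OF X.fibre_isoD(1)[OF s2(1)]]
  note cs = cat_simps[OF cats e f]
  \<comment> \<open>Inserting \<open>s1\<close> after its inverse moves \<open>r\<close> to \<open>w''\<close>, and \<open>w' w'' = e(w)\<close>.\<close>
  have "cmp X r s2 = cmp X s1 (mor e w)"
  proof -
    have "cmp X r s2 = cmp X (cmp X s1 (cmp X w' (lxiso LN1))) (cmp X r s2)"
      unfolding s1(2) using X.idn_cmp[of "cmp X r s2"] aw by (simp add: cs)
    also have "\<dots> = cmp X s1 (cmp X w' (cmp X (cmp X (lxiso LN1) r) s2))"
      using aw by (simp add: cs)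
    also have "\<dots> = cmp X s1 (cmp X (cmp X w' w'') (cmp X (mor e (lxiso L)) s2))"
      unfolding r(3)[symmetric] using aw by (simp add: cs)
    also have "\<dots> = cmp X s1 (mor e w)"
      unfolding s2(3) vw(2)[symmetric] using X.cmp_idn[of "cmp X w' w''"] aw by (simp add: cs)
    finally show ?thesis .
  qed
  then have D2G2: "is_base_change S W X e ?D2 ?G2 p l l0 k w"
    using lift_situation_base_change[OF cats e f _ D2 G2] b2(3) base_changeD(5)[OF DG] k r
    by (simp add: pair_map_def)
  have gen2: "generic_pair S ?D2 ?G2 p l l0"
  proof -
    have "generic_pair S N1 G p l l0"
      by (rule generic_pair_intermediate[OF gen d(1) n1(1) g(1) N1(1-3) _ _ inj pj])
        (use b1(3) b2(3) in \<open>simp_all add: pair_map_def\<close>)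
    then show ?thesis by (simp add: generic_pair_def)
  qed
  have L2: "is_lift W X e ?G2 ?L2"
  proof -
    note x = one_morphismD(1)[OF e lL(1)]
    have "cmp X (mor e (larr L)) (cmp X s2 (mor e (lxiso L))) = cmp X (idn X (obj e (lobj L))) (mor e (larr L))"
      unfolding s2(2) using X.cmp_idn[of "mor e (larr L)"] X.idn_cmp[of "mor e (larr L)"]
        one_morphism_simps[OF e] W.arrD(1-6)[OF lL(5)] by simp
    then show ?thesis
      using lL X.fibre_iso_idn[OF x] unfolding is_lift_def by simp
  qed
  have "generic_lift S W X e ?D2 ?G2 p l l0 k w ?L2"
    using gen2 D2G2 L2 by (simp add: generic_lift_def)
  moreover have "integral_situation ?D2" "algebraic_situation S ?D2"
    using D N1 by (simp_all add: integral_situation_def algebraic_situation_def)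
  ultimately obtain N2 LN2 where "integral_lift S W X e ?D2 ?G2 p l l0 k w ?L2 N2 LN2"
    using assms(8) D2 unfolding generic_lifts_integral_def by blast
  then obtain j2 p2 x' u' x'' u'' k2 where
    N2: "mid N2 = mid D" "red N2 = red D" "ext0 N2 = ext0 D" "is_lift W X e N2 LN2"
    and DN2: "is_base_change S W X e ?D2 N2 j2 (idhom (mid D)) (idhom (red D)) x' u'"
    and inj2: "inj_on (\<lambda>b. (p2 b, ext N2 b)) (carrier (big N2))"
    and pj2: "compose (carrier (big N1)) p2 j2 = p"
    and N2G: "is_base_change S W X e N2 ?G2 p2 l l0 x'' u''"
    and xu: "cmp X x' x'' = k" "cmp W u' u'' = w"
    and LL2: "is_lift_base_change W X e LN2 ?L2 p2 l x'' u'' k2"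
    unfolding integral_lift_def using N1 by auto
  note c1 = base_changeD[OF DN2, simplified] and c2 = base_changeD[OF N2G, simplified]
  note n2 = situationD[OF c1(2)] and lN2 = liftD[OF N2(4)]
  obtain n where n: "arr Y n (yobj G) (obj f (obj e (lobj L))) (idhom (big G))"
    "cmp Y n (lyiso L) = idn Y (obj f (obj e (lobj L)))" "cmp Y (lyiso L) n = idn Y (yobj G)"
    using Y.fibre_isoE[OF lL(7)] g(3) by metis

  \<comment> \<open>The target object of \<open>?N\<close> is \<open>f\<close> of the one of \<open>N2\<close>; it is a restriction of the target object of \<open>D\<close>
    via \<open>LN1\<close>, and the one of \<open>G\<close> is a restriction of it via the inverse \<open>n\<close> of the isomorphism of \<open>L\<close>.\<close>
  let ?N = "target_image f N2" and ?LN = "target_image_lift f LN2"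
  let ?idD = "idn W (xobj D)" and ?idG = "idn W (xobj G)"
  let ?v' = "cmp Y (cmp Y v' (lyiso LN1)) (mor f x')" and ?v'' = "cmp Y (mor f x'') n"
  note au = W.arrD(1-6)[OF c1(5)] W.arrD(1-6)[OF c2(5)] X.arrD(1-6)[OF c1(4)] X.arrD(1-6)[OF c2(4)]
    Y.arrD(1-6)[OF b1(4)] Y.arrD(1-6)[OF b2(4)] Y.arrD(1-6)[OF n(1)] Y.arrD(1-6)[OF lN1(10)]
    Y.arrD(1-6)[OF lL(10)]
  have u'': "cmp W ?idD u' = u'" "cmp W u'' ?idG = u''"
    using W.idn_cmp[of u'] W.cmp_idn[of u''] au by simp_all
  have id_mid: "compose (carrier (mid D)) (idhom (mid D)) (idhom (mid D)) = idhom (mid D)"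
    and id_red: "compose (carrier (red D)) (idhom (red D)) (idhom (red D)) = idhom (red D)"
    by (auto simp: compose_def)
  have DN: "is_base_change S W Y ?fe D ?N (compose (carrier (big D)) j2 j) (idhom (mid D)) (idhom (red D)) ?v' u'"
  proof -
    have s: "cmp X w' (cmp X (lxiso LN1) s1) = idn X (obj e (xobj D))"
      using s1(3) aw by (simp add: X.assoc)
    have "is_base_change S W Y ?fe D (target_image f ?D2) j (idhom (mid D)) (idhom (red D))
        (cmp Y v' (lyiso LN1)) ?idD"
      by (rule base_change_to_lift_situation[OF cats e f D' DN1 N1(4,1) D2 s])
    from base_change_trans[OF S cats(1,3) one_morphism_comp[OF e f] this
        target_image_base_change[OF cats e f DN2]]
    show ?thesis by (simp only: u'' id_mid id_red)
  qed
  have NG: "is_base_change S W Y ?fe ?N G p2 l l0 ?v'' u''"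
  proof -
    have "is_base_change S W Y ?fe (target_image f ?G2) G (idhom (big G)) (idhom (mid G)) (idhom (red G)) n ?idG"
      by (rule base_change_from_lift_situation[OF cats e f S G L G2 s2(3) n(1,2)])
    from base_change_trans[OF S cats(1,3) one_morphism_comp[OF e f]
        target_image_base_change[OF cats e f N2G] this]
    show ?thesis
      using c2(3) compose_idhom_left[of _ S] unfolding pair_map_def by (simp add: u'')
  qed
  have "compose (carrier (big D)) p2 (compose (carrier (big D)) j2 j) = l'"
    using compose_hom_assoc[of j S "big D" "big N1" p2 j2] b1(3) pj pj2 by (simp add: pair_map_def)
  moreover have "cmp Y ?v' ?v'' = v"
  proof -
    have "cmp Y ?v' ?v'' = cmp Y v' (cmp Y (cmp Y (lyiso LN1) (mor f (cmp X x' x''))) n)"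
      using au by (simp add: cs)
    also have "\<dots> = cmp Y (cmp Y v' v'') (cmp Y (lyiso L) n)"
      unfolding xu(1) kv[symmetric] using au by (simp add: cs)
    also have "\<dots> = v"
      unfolding n(3) vw(1)[symmetric] using Y.cmp_idn[of "cmp Y v' v''"] au by (simp add: cs)
    finally show ?thesis .
  qed
  moreover have "is_lift_base_change W Y ?fe ?LN L p2 l ?v'' u'' k2"
  proof -
    have k2: "arr W k2 (lobj L) (lobj LN2) p2"
      and x: "cmp X x'' (idn X (obj e (lobj L))) = cmp X (lyiso LN2) (mor e k2)"
      using LL2 by (simp_all add: is_lift_base_change_def)
    have "cmp Y ?v'' (lyiso L) = cmp Y (mor f x'') (cmp Y n (lyiso L))"
      using au by (simp add: cs)
    also have "\<dots> = mor f (cmp X x'' (idn X (obj e (lobj L))))"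
      unfolding n(2) using au X.cmp_idn[of x''] Y.cmp_idn[of "mor f x''"] by (simp add: cs)
    also have "\<dots> = cmp Y (mor f (lyiso LN2)) (mor f (mor e k2))"
      unfolding x using X.arrD(1-6)[OF lN2(10)] W.arrD(1-6)[OF k2] by (simp add: cs)
    finally show ?thesis
      using LL2 by (simp add: is_lift_base_change_def)
  qed
  ultimately have "integral_lift S W Y ?fe D G l' l l0 v w L ?N ?LN"
    unfolding integral_lift_def
  proof (intro conjI exI)
    show "inj_on (\<lambda>b. (p2 b, ext ?N b)) (carrier (big ?N))" using inj2 by simp
    show "is_lift W Y ?fe ?N ?LN" by (rule target_image_lift[OF cats e f c1(2) N2(4)])
  qed (use N2(1-3) DN NG xu(2) in simp_all)
  then show "\<exists>N LN. integral_lift S W Y ?fe D G l' l l0 v w L N LN"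
    by blast
qed

end
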